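(* Consider a finite sequence $\{\mathbf{B}_k\}$ of fixed complex matrices with dimension $d_1 \times d_2$, and let $\{\gamma_k\}$ be a finite sequence of independent standard normal random variables. Introduce the matrix Gaussian series $\mathbf{Z} = \sum_k \gamma_k \mathbf{B}_k$. Let $$v(\mathbf{Z}) = \max\big\{ \|\mathbb{E}(\mathbf{Z}\mathbf{Z}^* )\|,\ \|\mathbb{E}(\mathbf{Z}^*\mathbf{Z})\| \big\} = \max\left\{ \left\| \sum_k \mathbf{B}_k \mathbf{B}_k^* \right\|,\ \left\| \sum_k \mathbf{B}_k^* \mathbf{B}_k \right\| \right\}.$$ Then $$\mathbb{E}\, \|\mathbf{Z}\| \leq \sqrt{2\, v(\mathbf{Z}) \log(d_1 + d_2)}.$$ Furthermore, for all $t \geq 0$, $$\mathbb{P}\{ \|\mathbf{Z}\| \geq t \} \leq (d_1 + d_2)\, \exp\left( \frac{-t^2}{2\, v(\mathbf{Z})} \right).$$ The same bounds hold when $\{\gamma_k\}$ is replaced by a finite sequence $\{\varrho_k\}$ of independent Rademacher random variables.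
   Context: $\|\cdot\|$ is the spectral norm of a matrix (its largest singular value), ${}^*$ is the conjugate transpose, $\log$ is the natural logarithm. A standard normal random variable is a real Gaussian with mean zero and variance one. A Rademacher random variable takes the two values $\pm 1$ with equal probability. *)

theory Defs
  imports "HOL-Probability.Probability"
begin

definition conj_transpose :: "complex ^ 'n ^ 'm \<Rightarrow> complex ^ 'm ^ 'n" where
  "conj_transpose A = (\<chi> i j. cnj (A $ j $ i))"

(* The singular values of A are the square roots of the eigenvalues of A* A. If A has more
   columns than rows this admits additional zeros, which do not affect the largest one. *)
definition singular_value :: "complex ^ 'n ^ 'm \<Rightarrow> real \<Rightarrow> bool" where
  "singular_value A s \<longleftrightarrow>
     0 \<le> s \<and> (\<exists>x. x \<noteq> 0 \<and> (conj_transpose A ** A) *v x = complex_of_real (s\<^sup>2) *s x)"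

definition spectral_norm :: "complex ^ 'n ^ 'm \<Rightarrow> real" where
  "spectral_norm A = (GREATEST s. singular_value A s)"

definition rademacher :: "'a measure \<Rightarrow> ('a \<Rightarrow> real) \<Rightarrow> bool" where
  "rademacher M X \<longleftrightarrow> X \<in> borel_measurable M \<and>
     measure M {\<omega> \<in> space M. X \<omega> = 1} = 1 / 2 \<and>
     measure M {\<omega> \<in> space M. X \<omega> = - 1} = 1 / 2"

definition matrix_series ::
    "'k set \<Rightarrow> ('k \<Rightarrow> 'a \<Rightarrow> real) \<Rightarrow> ('k \<Rightarrow> complex ^ 'n ^ 'm) \<Rightarrow> 'a \<Rightarrow> complex ^ 'n ^ 'm" where
  "matrix_series K \<xi> B \<omega> = (\<Sum>k\<in>K. \<xi> k \<omega> *\<^sub>R B k)"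

definition matrix_variance :: "'a measure \<Rightarrow> ('a \<Rightarrow> complex ^ 'n ^ 'm) \<Rightarrow> real" where
  "matrix_variance M Z =
     max (spectral_norm (\<integral>\<omega>. Z \<omega> ** conj_transpose (Z \<omega>) \<partial>M))
         (spectral_norm (\<integral>\<omega>. conj_transpose (Z \<omega>) ** Z \<omega> \<partial>M))"

(* The largest singular value exists and is the operator norm for the Euclidean norms. *)

lemma inner_conj_transpose:
  "inner (A *v x) y = inner x (conj_transpose A *v y)" for A :: "complex ^ 'n ^ 'm"
proof -
  have "inner (A *v x) y = (\<Sum>i\<in>UNIV. \<Sum>j\<in>UNIV. Re (A $ i $ j * x $ j * cnj (y $ i)))"
    by (simp add: inner_vec_def matrix_vector_mult_def inner_complex_def sum_distrib_right
        flip: sum.distrib sum_distrib_left)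
  also have "\<dots> = (\<Sum>j\<in>UNIV. \<Sum>i\<in>UNIV. Re (A $ i $ j * x $ j * cnj (y $ i)))"
    by (rule sum.swap)
  also have "\<dots> = inner x (conj_transpose A *v y)"
    by (simp add: inner_vec_def matrix_vector_mult_def inner_complex_def conj_transpose_def
        sum_distrib_left algebra_simps flip: sum.distrib sum_subtractf)
  finally show ?thesis .
qed

lemma bounded_linear_complex_matrix:
  "bounded_linear ((*v) A)" for A :: "complex ^ 'n ^ 'm"
proof -
  have "linear ((*v) A)"
    by (intro linearI)
      (simp_all add: vec_eq_iff matrix_vector_mult_def sum.distrib algebra_simps scaleR_sum_right)
  then show ?thesis
    by (rule linear_conv_bounded_linear[THEN iffD1])
qed

lemma scaleC_of_real: "complex_of_real r *s x = r *\<^sub>R (x :: complex ^ 'n)"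
  by (simp add: vec_eq_iff) (simp add: scaleR_conv_of_real[where 'a = complex])

lemma singular_value_onorm:
  fixes A :: "complex ^ 'n ^ 'm"
  shows "singular_value A (onorm ((*v) A))"
    and "singular_value A s \<Longrightarrow> s \<le> onorm ((*v) A)"
proof -
  define m where "m = onorm ((*v) A)"
  note bl = bounded_linear_complex_matrix
  have le: "norm (A *v x) \<le> m * norm x" for x
    unfolding m_def by (rule onorm[OF bl])
  have m0: "0 \<le> m" unfolding m_def by (rule onorm_pos_le[OF bl])
  have norm2: "(norm (A *v x))\<^sup>2 = inner x ((conj_transpose A ** A) *v x)" for x
    by (simp add: power2_norm_eq_inner inner_conj_transpose matrix_vector_mul_assoc)
  have "norm (axis undefined (1::complex) :: complex ^ 'n) = 1"
    by (simp add: norm_axis_1)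
  then have ne: "sphere (0 :: complex ^ 'n) 1 \<noteq> {}"
    by (metis empty_iff mem_sphere_0)
  have "continuous_on (sphere 0 1) (\<lambda>x. norm (A *v x))"
    by (intro continuous_on_norm linear_continuous_on bl)
  then obtain u where u: "u \<in> sphere 0 1" "\<And>x. x \<in> sphere 0 1 \<Longrightarrow> norm (A *v x) \<le> norm (A *v u)"
    using continuous_attains_sup[OF compact_sphere ne] by blast
  have nu: "norm u = 1" using u(1) by simp
  have "norm (A *v x) \<le> norm (A *v u) * norm x" for x
  proof (cases "x = 0")
    case False
    have "norm (A *v (x /\<^sub>R norm x)) \<le> norm (A *v u)"
      using False by (intro u(2)) simp
    moreover have "A *v (x /\<^sub>R norm x) = (A *v x) /\<^sub>R norm x"
      using bl by (simp add: linear_cmul bounded_linear.linear)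
    ultimately show ?thesis using False by (simp add: field_simps)
  qed simp
  then have "m \<le> norm (A *v u)"
    unfolding m_def by (intro onorm_le) (simp add: mult.commute)
  with le[of u] nu have mu: "norm (A *v u) = m" by simp
  have le': "norm (conj_transpose A *v y) \<le> m * norm y" for y
  proof -
    let ?z = "conj_transpose A *v y"
    have "(norm ?z)\<^sup>2 = inner (A *v ?z) y"
      by (simp add: power2_norm_eq_inner inner_conj_transpose)
    also have "\<dots> \<le> norm (A *v ?z) * norm y" by (rule norm_cauchy_schwarz)
    also have "\<dots> \<le> m * norm ?z * norm y" by (intro mult_right_mono le) simp
    finally have "norm ?z * norm ?z \<le> (m * norm y) * norm ?z"
      by (simp add: power2_eq_square algebra_simps)
    then show ?thesis using m0 by (cases "?z = 0") auto
  qed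
  let ?P = "(conj_transpose A ** A) *v u"
  have "norm ?P \<le> m * m"
    using le'[of "A *v u"] mu by (simp add: matrix_vector_mul_assoc)
  then have P: "inner ?P ?P \<le> (m * m)\<^sup>2"
    unfolding power2_norm_eq_inner[symmetric] by (intro power_mono) simp_all
  have Pu: "inner u ?P = m * m" using norm2[of u] mu by (simp add: power2_eq_square)
  have uu: "inner u u = 1" using nu by (simp add: dot_square_norm)
  have "inner (?P - m\<^sup>2 *\<^sub>R u) (?P - m\<^sup>2 *\<^sub>R u) \<le> 0"
    using P Pu uu by (simp add: inner_diff inner_commute power2_eq_square algebra_simps)
  then have "?P - m\<^sup>2 *\<^sub>R u = 0" by (metis inner_eq_zero_iff inner_ge_zero order_antisym)
  then have eig: "?P = complex_of_real (m\<^sup>2) *s u" unfolding scaleC_of_real by simp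
  have u0: "u \<noteq> 0" using nu by force
  show "singular_value A (onorm ((*v) A))"
    unfolding singular_value_def m_def[symmetric] by (intro conjI exI[of _ u] m0 u0 eig)
  show "s \<le> onorm ((*v) A)" if sv: "singular_value A s"
  proof -
    obtain x where x: "x \<noteq> 0" "(conj_transpose A ** A) *v x = s\<^sup>2 *\<^sub>R x" and s: "0 \<le> s"
      using sv unfolding singular_value_def scaleC_of_real by blast
    have "(norm (A *v x))\<^sup>2 = (s * norm x)\<^sup>2"
      unfolding norm2 x(2) by (simp add: power_mult_distrib dot_square_norm)
    then have "norm (A *v x) = s * norm x" by (rule power2_eq_imp_eq) (simp_all add: s)
    with le[of x] x(1) show ?thesis unfolding m_def by simp
  qed
qed

lemma spectral_norm_eq_onorm: "spectral_norm A = onorm ((*v) A)"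
  unfolding spectral_norm_def by (intro Greatest_equality singular_value_onorm)

end

theory Submission
  imports Defs
begin

text \<open>
  The proof estimates all even trace moments of the Hermitian dilation \<open>X\<close> of \<open>Z\<close>; they already
  determine the constants in both bounds.
  Put \<open>d = d\<^sub>1 + d\<^sub>2\<close>. The dilation is again a series \<open>X = \<Sum> \<xi>\<^sub>k A\<^sub>k\<close>, with Hermitian coefficients
  whose squares add up to a matrix bounded by \<open>v\<close> (\<open>inner_sum_dilation_sq_le\<close>).

  The core is the recursion \<open>E tr X\<^sup>2\<^sup>p\<^sup>+\<^sup>2 \<le> (2 p + 1) v E tr X\<^sup>2\<^sup>p\<close> (\<open>hermitian_series_moment_step\<close>).
  Integration by parts in the variable \<open>\<xi>\<^sub>k\<close> replaces \<open>E \<xi>\<^sub>k tr (A\<^sub>k X\<^sup>2\<^sup>p\<^sup>+\<^sup>1)\<close> by a sum of \<open>2 p + 1\<close> terms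
  \<open>E tr (A\<^sub>k X\<^sup>q A\<^sub>k X\<^sup>2\<^sup>p\<^sup>-\<^sup>q)\<close>; for Rademacher signs a difference of two values plays the role of the
  derivative, and the two powers are those of two different matrices. If everything commuted, each term
  would be \<open>E tr (A\<^sub>k\<^sup>2 X\<^sup>2\<^sup>p)\<close>. In general the sum of the terms is still at most the commutative value:
  this is the trace inequality \<open>sum_sandwich_le\<close>, a consequence of the Cauchy--Schwarz inequality and a
  convexity argument. Summing over \<open>k\<close> and using \<open>\<Sum> A\<^sub>k\<^sup>2 \<le> v\<close> gives the recursion, and hence
  \<open>E tr X\<^sup>2\<^sup>p \<le> d (2 p - 1)!! v\<^sup>p\<close>.

  The dilation has both \<open>\<parallel>Z\<parallel>\<close> and \<open>-\<parallel>Z\<parallel>\<close> as eigenvalues, so \<open>2 \<parallel>Z\<parallel>\<^sup>2\<^sup>p \<le> tr X\<^sup>2\<^sup>p\<close>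
  (\<open>spectral_norm_power_le_dilation\<close>). The moments of \<open>\<parallel>Z\<parallel>\<close> are therefore at most \<open>d / 2\<close> times
  those of a Gaussian with variance \<open>v\<close>, and summing the series of \<open>2 cosh\<close> yields
  \<open>E exp (\<theta> \<parallel>Z\<parallel>) \<le> d exp (\<theta>\<^sup>2 v / 2)\<close> (\<open>exp_moment_from_even_moments\<close>). Both bounds follow
  by choosing \<open>\<theta>\<close> well (\<open>subgaussian_expectation_and_tail\<close>).
\<close>

section \<open>Matrix algebra with the Frobenius inner product\<close>

lemma conj_transpose_conj_transpose [simp]: "conj_transpose (conj_transpose A) = A"
  by (simp add: conj_transpose_def vec_eq_iff)

lemma conj_transpose_mult: "conj_transpose (A ** B) = conj_transpose B ** conj_transpose A"
  by (simp add: conj_transpose_def matrix_matrix_mult_def vec_eq_iff cnj_sum mult.commute)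

lemma conj_transpose_add: "conj_transpose (A + B) = conj_transpose A + conj_transpose B"
  by (simp add: conj_transpose_def vec_eq_iff)

lemma conj_transpose_scaleR: "conj_transpose (r *\<^sub>R A) = r *\<^sub>R conj_transpose A"
  by (simp add: conj_transpose_def vec_eq_iff)

lemma conj_transpose_sum: "conj_transpose (sum f S) = (\<Sum>s\<in>S. conj_transpose (f s))"
  by (simp add: conj_transpose_def vec_eq_iff cnj_sum)

lemma conj_transpose_mat_1 [simp]: "conj_transpose (mat 1) = mat 1"
  by (simp add: conj_transpose_def mat_def vec_eq_iff)

lemma bounded_bilinear_matrix_mult:
  "bounded_bilinear ((**) :: complex^'n^'m \<Rightarrow> complex^'p^'n \<Rightarrow> complex^'p^'m)"
proof -
  have "bilinear ((**) :: complex^'n^'m \<Rightarrow> complex^'p^'n \<Rightarrow> complex^'p^'m)"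
    unfolding bilinear_def
    by (auto intro!: linearI simp: matrix_matrix_mult_def vec_eq_iff sum.distrib
        distrib_left distrib_right scaleR_sum_right)
  then show ?thesis
    by (simp add: bilinear_conv_bounded_bilinear)
qed

lemmas matrix_mult_add_left = bounded_bilinear.add_left [OF bounded_bilinear_matrix_mult]
  and matrix_mult_diff_left = bounded_bilinear.diff_left [OF bounded_bilinear_matrix_mult]
  and matrix_mult_diff_right = bounded_bilinear.diff_right [OF bounded_bilinear_matrix_mult]
  and matrix_mult_scaleR_left = bounded_bilinear.scaleR_left [OF bounded_bilinear_matrix_mult]
  and matrix_mult_scaleR_right = bounded_bilinear.scaleR_right [OF bounded_bilinear_matrix_mult]
  and matrix_mult_sum_left = bounded_bilinear.sum_left [OF bounded_bilinear_matrix_mult]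
  and matrix_mult_sum_right = bounded_bilinear.sum_right [OF bounded_bilinear_matrix_mult]

lemma column_matrix_mult: "column j (A ** P) = A *v column j P"
  by (simp add: column_def matrix_matrix_mult_def matrix_vector_mult_def vec_eq_iff)

text \<open>The real inner product that \<^typ>\<open>complex^'n^'m\<close> carries as an iterated vector space is
\<open>Re (tr (P\<^sup>* Q))\<close>, which expresses traces: \<open>tr X\<^sup>2\<^sup>p\<close> is the squared
norm of \<open>X\<^sup>p\<close> for Hermitian \<open>X\<close>, and cyclicity of the trace becomes the two adjunction rules
below, which move a factor to the other argument.\<close>

lemma inner_matrix_columns:
  fixes P Q :: "complex^'n^'m"
  shows "inner P Q = (\<Sum>j\<in>UNIV. inner (column j P) (column j Q))"
  unfolding inner_vec_def column_def by (simp add: sum.swap[of _ "UNIV :: 'n set"])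

lemma inner_conj_transpose_conj_transpose:
  "inner (conj_transpose P) (conj_transpose Q) = inner P Q"
  unfolding inner_vec_def conj_transpose_def inner_complex_def
  by (simp, subst sum.swap, rule refl)

lemma inner_matrix_mult_left: "inner (A ** P) Q = inner P (conj_transpose A ** Q)"
  by (simp add: inner_matrix_columns column_matrix_mult inner_conj_transpose)

lemma inner_matrix_mult_right: "inner (P ** A) Q = inner P (Q ** conj_transpose A)"
  using inner_matrix_mult_left[of "conj_transpose A" "conj_transpose P" "conj_transpose Q"]
  by (metis conj_transpose_conj_transpose conj_transpose_mult inner_conj_transpose_conj_transpose)

definition hermitian :: "complex^'n^'n \<Rightarrow> bool" where
  "hermitian A \<longleftrightarrow> conj_transpose A = A"

lemma hermitian_add: "hermitian A \<Longrightarrow> hermitian B \<Longrightarrow> hermitian (A + B)"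
  and hermitian_scaleR: "hermitian A \<Longrightarrow> hermitian (r *\<^sub>R A)"
  by (simp_all add: hermitian_def conj_transpose_add conj_transpose_scaleR)

lemma hermitian_sum: "(\<And>s. s \<in> S \<Longrightarrow> hermitian (f s)) \<Longrightarrow> hermitian (sum f S)"
  by (simp add: hermitian_def conj_transpose_sum)

primrec matrix_power :: "complex^'n^'n \<Rightarrow> nat \<Rightarrow> complex^'n^'n" where
  "matrix_power A 0 = mat 1"
| "matrix_power A (Suc n) = A ** matrix_power A n"

lemma matrix_power_add: "matrix_power A (m + n) = matrix_power A m ** matrix_power A n"
  by (induction m) (simp_all add: matrix_mul_assoc)

lemma matrix_power_Suc_right: "matrix_power A (Suc n) = matrix_power A n ** A"
  using matrix_power_add[of A n 1] by simp

lemma hermitian_matrix_power: "hermitian A \<Longrightarrow> hermitian (matrix_power A n)"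
proof (induction n)
  case (Suc n)
  then show ?case
    unfolding hermitian_def matrix_power.simps(2) conj_transpose_mult
    by (metis matrix_power.simps(2) matrix_power_Suc_right)
qed (simp add: hermitian_def)

lemma norm_matrix_power_sq:
  assumes "hermitian A"
  shows "(norm (matrix_power A n))\<^sup>2 = inner (mat 1) (matrix_power A (2 * n))"
proof -
  have "(norm (matrix_power A n))\<^sup>2 = inner (matrix_power A n ** mat 1) (matrix_power A n)"
    by (simp add: power2_norm_eq_inner)
  also have "\<dots> = inner (mat 1) (matrix_power A n ** matrix_power A n)"
    using hermitian_matrix_power[OF assms, of n]
    unfolding inner_matrix_mult_left hermitian_def by simp
  finally show ?thesis
    by (simp add: mult_2 matrix_power_add)
qed

lemma norm_matrix_power_le:
  obtains C where "\<And>A :: complex^'n^'n. norm (matrix_power A n) \<le> C * norm A ^ n" "0 \<le> C"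
proof -
  from bounded_bilinear.pos_bounded[OF bounded_bilinear_matrix_mult]
  obtain K where K: "0 < K" "\<And>(A :: complex^'n^'n) (B :: complex^'n^'n). norm (A ** B) \<le> norm A * norm B * K"
    by blast
  have "norm (matrix_power A n) \<le> norm (mat 1 :: complex^'n^'n) * K ^ n * norm A ^ n" for A :: "complex^'n^'n"
  proof (induction n)
    case (Suc n)
    have "norm (matrix_power A (Suc n)) \<le> norm A * norm (matrix_power A n) * K"
      unfolding matrix_power.simps by (rule K(2))
    also have "\<dots> \<le> norm A * (norm (mat 1 :: complex^'n^'n) * K ^ n * norm A ^ n) * K"
      using K(1) by (intro mult_right_mono mult_left_mono Suc) auto
    finally show ?case
      by (simp add: mult_ac)
  qed simp
  then show thesis
    using K(1) by (intro that[of "norm (mat 1 :: complex^'n^'n) * K ^ n"]) auto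
qed

lemma inner_mult_le_quadratic_form:
  fixes V :: "complex^'n^'n" and P :: "complex^'m^'n"
  assumes "\<And>x. inner (V *v x) x \<le> v * (norm x)\<^sup>2"
  shows "inner (V ** P) P \<le> v * (norm P)\<^sup>2"
proof -
  have "inner (V ** P) P = (\<Sum>j\<in>UNIV. inner (V *v column j P) (column j P))"
    by (simp add: inner_matrix_columns column_matrix_mult)
  also have "\<dots> \<le> (\<Sum>j\<in>UNIV. v * (norm (column j P))\<^sup>2)"
    by (intro sum_mono assms)
  also have "\<dots> = v * (norm P)\<^sup>2"
    by (simp add: power2_norm_eq_inner inner_matrix_columns sum_distrib_left)
  finally show ?thesis .
qed

section \<open>A trace inequality for sandwiched powers\<close>

text \<open>The noncommutative form of \<open>w\<^sup>n - y\<^sup>n = (w - y) (\<Sum> w\<^sup>q y\<^sup>n\<^sup>-\<^sup>1\<^sup>-\<^sup>q)\<close>. It serves both the finite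
difference that arises for Rademacher signs and the difference quotient that arises for Gaussians.\<close>

lemma matrix_power_diff:
  "matrix_power W n - matrix_power Y n =
     (\<Sum>q<n. matrix_power W q ** (W - Y) ** matrix_power Y (n - Suc q))"
proof (induction n)
  case (Suc n)
  have "matrix_power W (Suc n) - matrix_power Y (Suc n) =
      W ** (matrix_power W n - matrix_power Y n) + (W - Y) ** matrix_power Y n"
    by (simp add: matrix_mult_diff_left matrix_mult_diff_right)
  also have "W ** (matrix_power W n - matrix_power Y n) =
      (\<Sum>q<n. matrix_power W (Suc q) ** (W - Y) ** matrix_power Y (n - Suc q))"
    unfolding Suc by (simp add: matrix_mult_sum_right matrix_mul_assoc)
  finally show ?case
    by (subst sum.lessThan_Suc_shift) (simp del: matrix_power.simps(2))
qed simp

text \<open>A sequence that lies below the midpoints of its even-indexed values is dominated, after folding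
around the centre, by its two ends. The folded sequence attains its maximum at some \<open>s\<close> in the left
half; the hypothesis for the pair \<open>0, s\<close> bounds twice this maximum by the value at \<open>0\<close> plus the
value at \<open>2 s\<close>, which is again at most the maximum.\<close>

lemma midpoint_convex_endpoints:
  fixes c :: "nat \<Rightarrow> real"
  assumes mid: "\<And>i j. i \<le> r \<Longrightarrow> j \<le> r \<Longrightarrow> 2 * c (i + j) \<le> c (2 * i) + c (2 * j)"
    and q: "q \<le> 2 * r"
  shows "c q + c (2 * r - q) \<le> c 0 + c (2 * r)"
proof -
  define g where "g q = c q + c (2 * r - q)" for q
  have gmid: "2 * g (i + j) \<le> g (2 * i) + g (2 * j)" if "i \<le> r" "j \<le> r" for i j
  proof -
    have "(r - i) + (r - j) = 2 * r - (i + j)" "2 * (r - i) = 2 * r - 2 * i" "2 * (r - j) = 2 * r - 2 * j"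
      using that by auto
    then show ?thesis
      using mid[of i j] mid[of "r - i" "r - j"] that unfolding g_def by simp
  qed
  obtain p where p: "p \<le> 2 * r" "\<And>q. q \<le> 2 * r \<Longrightarrow> g q \<le> g p"
  proof -
    have "Max (g ` {..2 * r}) \<in> g ` {..2 * r}"
      by (intro Max_in) auto
    then obtain p where "p \<le> 2 * r" "Max (g ` {..2 * r}) = g p"
      by (metis (no_types, lifting) atMost_iff imageE)
    moreover from this have "g q \<le> g p" if "q \<le> 2 * r" for q
      using Max_ge[of "g ` {..2 * r}" "g q"] that by simp
    ultimately show thesis
      using that by blast
  qed
  define s where "s = min p (2 * r - p)"
  have s: "s \<le> r" "g s = g p"
    using p(1) by (auto simp: s_def g_def min_def)
  have "2 * g s \<le> g 0 + g (2 * s)"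
    using gmid[of 0 s] s(1) by simp
  moreover have "g (2 * s) \<le> g s"
    using p(2) s by simp
  ultimately have "g p \<le> g 0"
    using s by simp
  then show ?thesis
    using p(2)[OF q] by (simp add: g_def)
qed

text \<open>In an eigenbasis this is the inequality \<open>a\<^sup>q b\<^sup>m\<^sup>-\<^sup>q + a\<^sup>m\<^sup>-\<^sup>q b\<^sup>q \<le> a\<^sup>m + b\<^sup>m\<close> for even \<open>m\<close>, summed
over \<open>q\<close>. The Frobenius inner product replaces the eigenbasis: writing \<open>P\<^sub>k = W\<^sup>k A Y\<^sup>r\<^sup>-\<^sup>k\<close>, the summand with index
\<open>i + j\<close> is the inner product of \<open>P\<^sub>i\<close> and \<open>P\<^sub>j\<close>, so that \<open>2 \<langle>P\<^sub>i, P\<^sub>j\<rangle> \<le> \<parallel>P\<^sub>i\<parallel>\<^sup>2 + \<parallel>P\<^sub>j\<parallel>\<^sup>2\<close>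
makes the summands midpoint convex.\<close>

lemma sum_sandwich_le:
  fixes A W Y :: "complex^'n^'n"
  assumes A: "hermitian A" and W: "hermitian W" and Y: "hermitian Y"
  shows "(\<Sum>q<2 * r + 1. inner A (matrix_power W q ** A ** matrix_power Y (2 * r - q)))
     \<le> (2 * real r + 1) / 2 * (inner (A ** A) (matrix_power W (2 * r)) + inner (A ** A) (matrix_power Y (2 * r)))"
proof -
  define c where "c q = inner A (matrix_power W q ** A ** matrix_power Y (2 * r - q))" for q
  have ct [simp]: "conj_transpose A = A" "conj_transpose (matrix_power W n) = matrix_power W n"
    "conj_transpose (matrix_power Y n) = matrix_power Y n" for n
    using A hermitian_matrix_power[OF W] hermitian_matrix_power[OF Y] by (auto simp: hermitian_def)
  have mid: "2 * c (i + j) \<le> c (2 * i) + c (2 * j)" if "i \<le> r" "j \<le> r" for i j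
  proof -
    define P where "P k = matrix_power W k ** A ** matrix_power Y (r - k)" for k
    have eq: "inner (P k) (P l) = c (k + l)" if "k \<le> r" "l \<le> r" for k l
    proof -
      have "2 * r - (k + l) = (r - l) + (r - k)"
        using that by simp
      moreover have "inner (P k) (P l) = inner (A ** matrix_power Y (r - k)) (matrix_power W k ** P l)"
        by (simp add: P_def inner_matrix_mult_left flip: matrix_mul_assoc)
      ultimately show ?thesis
        by (simp add: inner_matrix_mult_right c_def P_def matrix_power_add matrix_mul_assoc)
    qed
    have "0 \<le> inner (P i - P j) (P i - P j)"
      by simp
    also have "\<dots> = inner (P i) (P i) + inner (P j) (P j) - 2 * inner (P i) (P j)"
      by (simp add: inner_diff inner_commute)
    finally show ?thesis
      unfolding eq[OF that] eq[OF that(1) that(1)] eq[OF that(2) that(2)] by (simp flip: mult_2)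
  qed
  \<comment> \<open>Pair each index with its mirror image, so that the endpoint bound applies to every pair.\<close>
  have "2 * (\<Sum>q<2 * r + 1. c q) = (\<Sum>q<2 * r + 1. c q) + (\<Sum>q<2 * r + 1. c (2 * r + 1 - Suc q))"
    using sum.nat_diff_reindex[of c "2 * r + 1"] by simp
  also have "\<dots> = (\<Sum>q<2 * r + 1. c q + c (2 * r - q))"
    by (simp add: sum.distrib)
  also have "\<dots> \<le> (\<Sum>q<2 * r + 1. c 0 + c (2 * r))"
    by (intro sum_mono midpoint_convex_endpoints mid) auto
  also have "\<dots> = (2 * real r + 1) * (c 0 + c (2 * r))"
    by simp
  finally have "(\<Sum>q<2 * r + 1. c q) \<le> (2 * real r + 1) / 2 * (c 0 + c (2 * r))"
    by simp
  moreover have "c 0 = inner (A ** A) (matrix_power Y (2 * r))"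
    by (simp add: c_def inner_matrix_mult_left)
  moreover have "c (2 * r) = inner (A ** A) (matrix_power W (2 * r))"
    by (simp add: c_def inner_matrix_mult_right)
  ultimately show ?thesis
    unfolding c_def by (simp add: add.commute)
qed

section \<open>Hermitian dilation\<close>

definition join_vec :: "complex^'m \<Rightarrow> complex^'n \<Rightarrow> complex^('m + 'n)" where
  "join_vec x y = (\<chi> i. case i of Inl a \<Rightarrow> x $ a | Inr b \<Rightarrow> y $ b)"

text \<open>The Hermitian block matrix with zero diagonal blocks and off-diagonal blocks \<open>Z\<close> and \<open>Z\<^sup>*\<close>.\<close>

definition dilation :: "complex^'n^'m \<Rightarrow> complex^('m + 'n)^('m + 'n)" where
  "dilation Z = (\<chi> i. case i of
      Inl a \<Rightarrow> join_vec 0 (Z $ a)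
    | Inr b \<Rightarrow> join_vec (conj_transpose Z $ b) 0)"

lemma sum_UNIV_Plus:
  "(\<Sum>i\<in>UNIV. f i) = (\<Sum>a\<in>UNIV. f (Inl a)) + (\<Sum>b\<in>UNIV. f (Inr b))"
  for f :: "'a::finite + 'b::finite \<Rightarrow> 'c::comm_monoid_add"
  using sum.Plus[of "UNIV :: 'a set" "UNIV :: 'b set" f] by (simp add: comp_def)

lemma join_vec_cases:
  obtains x y where "z = join_vec x y"
proof
  show "z = join_vec (\<chi> a. z $ Inl a) (\<chi> b. z $ Inr b)"
    by (simp add: join_vec_def vec_eq_iff split: sum.split)
qed

lemma inner_join_vec: "inner (join_vec x y) (join_vec x' y') = inner x x' + inner y y'"
  by (simp add: inner_vec_def sum_UNIV_Plus join_vec_def)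

lemma norm_join_vec_sq: "(norm (join_vec x y))\<^sup>2 = (norm x)\<^sup>2 + (norm y)\<^sup>2"
  by (simp add: power2_norm_eq_inner inner_join_vec)

lemma join_vec_add: "join_vec x y + join_vec x' y' = join_vec (x + x') (y + y')"
  by (simp add: join_vec_def vec_eq_iff split: sum.split)

lemma join_vec_scaleR: "r *\<^sub>R join_vec x y = join_vec (r *\<^sub>R x) (r *\<^sub>R y)"
  by (simp add: join_vec_def vec_eq_iff split: sum.split)

lemma join_vec_0: "join_vec 0 0 = 0"
  by (simp add: join_vec_def vec_eq_iff split: sum.split)

lemma join_vec_sum: "(\<Sum>k\<in>K. join_vec (f k) (g k)) = join_vec (sum f K) (sum g K)"
  by (induction K rule: infinite_finite_induct) (simp_all add: join_vec_0 join_vec_add)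

lemma dilation_mult_vec:
  "dilation Z *v join_vec x y = join_vec (Z *v y) (conj_transpose Z *v x)"
  by (simp add: dilation_def join_vec_def matrix_vector_mult_def vec_eq_iff sum_UNIV_Plus
      split: sum.split)

lemma hermitian_dilation: "hermitian (dilation Z)"
  unfolding hermitian_def
  by (simp add: dilation_def join_vec_def conj_transpose_def vec_eq_iff split: sum.split)

lemma linear_dilation: "linear dilation"
  by (intro linearI)
     (simp_all add: dilation_def join_vec_def conj_transpose_def vec_eq_iff split: sum.split)

lemma matrix_vector_mult_sum_left: "(\<Sum>k\<in>K. A k) *v x = (\<Sum>k\<in>K. A k *v x)"
  for A :: "'k \<Rightarrow> complex^'n^'m"
  by (induction K rule: infinite_finite_induct) (simp_all add: matrix_vector_mult_add_rdistrib)

lemma inner_mult_vec_le_spectral_norm: "inner (A *v x) x \<le> spectral_norm A * (norm x)\<^sup>2"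
  for A :: "complex^'n^'n"
proof -
  have "inner (A *v x) x \<le> norm (A *v x) * norm x"
    by (rule norm_cauchy_schwarz)
  also have "\<dots> \<le> spectral_norm A * norm x * norm x"
    unfolding spectral_norm_eq_onorm
    by (intro mult_right_mono onorm bounded_linear_complex_matrix) auto
  finally show ?thesis
    by (simp add: power2_eq_square)
qed

text \<open>The square of a dilation is block diagonal with blocks \<open>Z Z\<^sup>*\<close> and \<open>Z\<^sup>* Z\<close>; this is where the maximum
of two norms in the matrix variance comes from.\<close>

lemma inner_sum_dilation_sq_le:
  fixes B :: "'k \<Rightarrow> complex^'n^'m"
  shows "inner ((\<Sum>k\<in>K. dilation (B k) ** dilation (B k)) *v z) z
    \<le> max (spectral_norm (\<Sum>k\<in>K. B k ** conj_transpose (B k)))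
           (spectral_norm (\<Sum>k\<in>K. conj_transpose (B k) ** B k)) * (norm z)\<^sup>2"
    (is "_ \<le> max ?v1 ?v2 * _")
proof -
  obtain x y where z: "z = join_vec x y"
    by (rule join_vec_cases)
  have "(\<Sum>k\<in>K. dilation (B k) ** dilation (B k)) *v z =
     join_vec ((\<Sum>k\<in>K. B k ** conj_transpose (B k)) *v x) ((\<Sum>k\<in>K. conj_transpose (B k) ** B k) *v y)"
    by (simp add: z matrix_vector_mult_sum_left dilation_mult_vec join_vec_sum
        flip: matrix_vector_mul_assoc)
  then have "inner ((\<Sum>k\<in>K. dilation (B k) ** dilation (B k)) *v z) z =
     inner ((\<Sum>k\<in>K. B k ** conj_transpose (B k)) *v x) x + inner ((\<Sum>k\<in>K. conj_transpose (B k) ** B k) *v y) y"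
    by (simp add: z inner_join_vec)
  also have "\<dots> \<le> ?v1 * (norm x)\<^sup>2 + ?v2 * (norm y)\<^sup>2"
    by (intro add_mono inner_mult_vec_le_spectral_norm)
  also have "\<dots> \<le> max ?v1 ?v2 * (norm x)\<^sup>2 + max ?v1 ?v2 * (norm y)\<^sup>2"
    by (intro add_mono mult_right_mono) auto
  also have "\<dots> = max ?v1 ?v2 * (norm z)\<^sup>2"
    unfolding z norm_join_vec_sq by (simp only: distrib_left)
  finally show ?thesis .
qed

lemma norm_row_mult_vec_le: "(norm (\<Sum>a\<in>S. p a * q a))\<^sup>2 \<le> (\<Sum>a\<in>S. (norm (p a))\<^sup>2) * (\<Sum>a\<in>S. (norm (q a))\<^sup>2)"
  for p q :: "'a \<Rightarrow> complex"
proof -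
  have "norm (\<Sum>a\<in>S. p a * q a) \<le> (\<Sum>a\<in>S. norm (p a) * norm (q a))"
    by (rule order_trans[OF norm_sum]) (simp add: norm_mult)
  then have "(norm (\<Sum>a\<in>S. p a * q a))\<^sup>2 \<le> (\<Sum>a\<in>S. norm (p a) * norm (q a))\<^sup>2"
    by (intro power_mono) auto
  also have "\<dots> \<le> (\<Sum>a\<in>S. (norm (p a))\<^sup>2) * (\<Sum>a\<in>S. (norm (q a))\<^sup>2)"
    by (rule Cauchy_Schwarz_ineq_sum)
  finally show ?thesis .
qed

text \<open>Each row of \<open>P\<close> splits into two parts that meet the two test vectors separately, so the
Cauchy--Schwarz inequality can be applied to both without counting any entry twice.\<close>

lemma norm_block_vectors_le:
  fixes P :: "complex^('m::finite + 'n::finite)^'p"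
  assumes x: "norm x = 1" and y: "norm y = 1"
  shows "(norm (P *v join_vec x 0))\<^sup>2 + (norm (P *v join_vec 0 y))\<^sup>2 \<le> (norm P)\<^sup>2"
proof -
  have sq: "(norm v)\<^sup>2 = (\<Sum>i\<in>UNIV. (norm (v $ i))\<^sup>2)" for v :: "'b::real_inner^'c"
    by (simp add: power2_norm_eq_inner inner_vec_def)
  have x1: "(\<Sum>a\<in>UNIV. (norm (x $ a))\<^sup>2) = 1" and y1: "(\<Sum>b\<in>UNIV. (norm (y $ b))\<^sup>2) = 1"
    using x y sq[of x] sq[of y] by simp_all
  have "(norm (P *v join_vec x 0))\<^sup>2 + (norm (P *v join_vec 0 y))\<^sup>2 =
     (\<Sum>i\<in>UNIV. (norm (\<Sum>a\<in>UNIV. P $ i $ Inl a * x $ a))\<^sup>2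
               + (norm (\<Sum>b\<in>UNIV. P $ i $ Inr b * y $ b))\<^sup>2)"
    by (simp add: sq matrix_vector_mult_def sum_UNIV_Plus join_vec_def sum.distrib)
  also have "\<dots> \<le> (\<Sum>i\<in>UNIV. (\<Sum>a\<in>UNIV. (norm (P $ i $ Inl a))\<^sup>2) + (\<Sum>b\<in>UNIV. (norm (P $ i $ Inr b))\<^sup>2))"
    using norm_row_mult_vec_le[of _ "\<lambda>a. x $ a" UNIV] norm_row_mult_vec_le[of _ "\<lambda>b. y $ b" UNIV] x1 y1
    by (intro sum_mono add_mono) auto
  also have "\<dots> = (norm P)\<^sup>2"
    by (simp add: sq sum_UNIV_Plus)
  finally show ?thesis .
qed

lemma norm_mat_1_sq: "(norm (mat 1 :: complex^'n^'n))\<^sup>2 = real CARD('n)"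
  by (simp add: power2_norm_eq_inner inner_vec_def mat_def inner_complex_def if_distrib cong: if_cong)

lemma spectral_norm_nonneg: "0 \<le> spectral_norm A"
  unfolding spectral_norm_eq_onorm by (intro onorm_pos_le bounded_linear_complex_matrix)

text \<open>The nonzero eigenvalues of the dilation come in pairs of opposite sign, so \<open>\<parallel>Z\<parallel>\<^sup>2\<^sup>p\<close> occurs at least twice in
the trace of its even power. The factor \<open>2\<close> is essential: it cancels the factor lost later in
\<open>exp x \<le> 2 cosh x\<close>, and so keeps the dimensional constant at \<open>d\<^sub>1 + d\<^sub>2\<close>. If \<open>u\<close> is a unit right
singular vector for \<open>s = \<parallel>Z\<parallel> > 0\<close> and \<open>w = Z u / s\<close>, the dilation maps the block vectors \<open>(w, 0)\<close> and
\<open>(0, u)\<close> to \<open>s\<close> times each other. For \<open>p = 0\<close> the trace is the dimension, which is at least \<open>2\<close>.\<close>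

lemma spectral_norm_power_le_dilation:
  fixes Z :: "complex^'n^'m"
  shows "2 * spectral_norm Z ^ (2 * p) \<le> (norm (matrix_power (dilation Z) p))\<^sup>2"
proof -
  define s where "s = spectral_norm Z"
  have s0: "0 \<le> s"
    unfolding s_def by (rule spectral_norm_nonneg)
  consider "p = 0" | "p \<noteq> 0" "s = 0" | "s > 0"
    using s0 by linarith
  then show ?thesis
  proof cases
    case 1
    have "1 \<le> real CARD('m)" "1 \<le> real CARD('n)"
      by (simp_all add: Suc_leI)
    moreover have "(norm (mat 1 :: complex^('m + 'n)^('m + 'n)))\<^sup>2 = real CARD('m) + real CARD('n)"
      by (simp add: norm_mat_1_sq)
    ultimately show ?thesis
      using 1 by (simp only: power_0 mult_0_right matrix_power.simps)
  next
    case 2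
    then show ?thesis
      unfolding s_def by (simp add: power_0_left)
  next
    case 3
    have "singular_value Z s"
      unfolding s_def spectral_norm_eq_onorm by (rule singular_value_onorm)
    then obtain u0 where u0: "u0 \<noteq> 0" "(conj_transpose Z ** Z) *v u0 = s\<^sup>2 *\<^sub>R u0"
      unfolding singular_value_def scaleC_of_real by blast
    define u where "u = u0 /\<^sub>R norm u0"
    define w where "w = (Z *v u) /\<^sub>R s"
    have lin: "A *v (r *\<^sub>R x) = r *\<^sub>R (A *v x)" for A :: "complex^'b^'c" and r x
      by (rule linear_cmul[OF bounded_linear.linear[OF bounded_linear_complex_matrix]])
    have nu: "norm u = 1"
      using u0(1) by (simp add: u_def)
    have ZZu: "conj_transpose Z *v (Z *v u) = s\<^sup>2 *\<^sub>R u"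
      using u0(2) by (simp add: u_def lin matrix_vector_mul_assoc)
    have Zu: "Z *v u = s *\<^sub>R w"
      using 3 by (simp add: w_def)
    have Zw: "conj_transpose Z *v w = s *\<^sub>R u"
      using 3 unfolding w_def lin ZZu by (simp add: power2_eq_square)
    have "(norm (Z *v u))\<^sup>2 = inner u (conj_transpose Z *v (Z *v u))"
      by (simp add: power2_norm_eq_inner inner_conj_transpose)
    also have "\<dots> = s\<^sup>2"
      unfolding ZZu using nu by (simp add: dot_square_norm)
    finally have "norm (Z *v u) = s"
      using s0 by (simp add: power2_eq_iff_nonneg)
    then have nw: "norm w = 1"
      using 3 by (simp add: w_def)
    have "norm (matrix_power (dilation Z) p *v join_vec w 0) = s ^ p \<and>
          norm (matrix_power (dilation Z) p *v join_vec 0 u) = s ^ p"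
    proof (induction p)
      case 0
      have "norm (join_vec w (0::complex^'n)) = 1" "norm (join_vec (0::complex^'m) u) = 1"
        using norm_join_vec_sq[of w "0::complex^'n"] norm_join_vec_sq[of "0::complex^'m" u] nu nw
        by (simp_all add: power2_eq_iff_nonneg[where y = 1, simplified])
      then show ?case
        by simp
    next
      case (Suc p)
      have "dilation Z *v join_vec w 0 = s *\<^sub>R join_vec 0 u" "dilation Z *v join_vec 0 u = s *\<^sub>R join_vec w 0"
        by (simp_all add: dilation_mult_vec Zw Zu join_vec_scaleR)
      then show ?case
        using Suc s0 unfolding matrix_power_Suc_right
        by (simp add: lin flip: matrix_vector_mul_assoc)
    qed
    then have "2 * (s ^ p)\<^sup>2 \<le> (norm (matrix_power (dilation Z) p))\<^sup>2"
      using norm_block_vectors_le[OF nw nu, of "matrix_power (dilation Z) p"] by simp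
    then show ?thesis
      by (simp add: s_def power_mult mult.commute)
  qed
qed

section \<open>Integration by parts in one random coefficient\<close>

text \<open>The two sides of a one-variable integration by parts inequality along the line \<open>x A + Y\<close> of Hermitian
matrices. For a standard Gaussian \<open>\<gamma>\<close>, the expectation of \<open>\<gamma> f(\<gamma>)\<close> equals that of \<open>f'(\<gamma>)\<close>; for
scalars \<open>A = 1\<close> and \<open>f(x) = (x + Y)\<^sup>2\<^sup>p\<^sup>+\<^sup>1\<close> this says that the expected gap is zero. All that the
moment recursion uses about the law of the coefficients is that the expected gap is nonnegative.\<close>

definition stein_gap :: "complex^'n^'n \<Rightarrow> complex^'n^'n \<Rightarrow> nat \<Rightarrow> real \<Rightarrow> real" where
  "stein_gap A Y p x =
     (2 * real p + 1) * inner (A ** A) (matrix_power (x *\<^sub>R A + Y) (2 * p))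
     - x * inner A (matrix_power (x *\<^sub>R A + Y) (2 * p + 1))"

text \<open>The expectation of the gap for a Rademacher sign, up to a factor \<open>2\<close>: the difference of powers of
\<open>Y + A\<close> and \<open>Y - A\<close> telescopes into the sandwiched products with two different outer matrices.\<close>

lemma stein_gap_symmetric_nonneg:
  assumes A: "hermitian A" and Y: "hermitian Y"
  shows "0 \<le> stein_gap A Y p 1 + stein_gap A Y p (- 1)"
proof -
  define W where "W = A + Y"
  define V where "V = Y - A"
  have h: "hermitian W" "hermitian V"
    using A Y hermitian_add[OF Y hermitian_scaleR[OF A, of "- 1"]] by (simp_all add: W_def V_def hermitian_add)
  have WV: "W - V = 2 *\<^sub>R A"
    by (simp add: W_def V_def scaleR_2)
  have "inner A (matrix_power W (2 * p + 1)) - inner A (matrix_power V (2 * p + 1)) =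
     2 * (\<Sum>q<2 * p + 1. inner A (matrix_power W q ** A ** matrix_power V (2 * p - q)))"
    unfolding inner_diff_right[symmetric] matrix_power_diff WV
    by (simp only: matrix_mult_scaleR_left matrix_mult_scaleR_right inner_sum_right inner_scaleR_right
        sum_distrib_left Suc_eq_plus1 add_diff_cancel_right diff_add_inverse2 diff_Suc_1)
  also have "\<dots> \<le> (2 * real p + 1) * (inner (A ** A) (matrix_power W (2 * p)) + inner (A ** A) (matrix_power V (2 * p)))"
    using sum_sandwich_le[OF A h, of p] by simp
  finally show ?thesis
    unfolding stein_gap_def by (simp add: W_def V_def algebra_simps)
qed

lemma continuous_on_matrix_power [continuous_intros]:
  assumes "continuous_on S f"
  shows "continuous_on S (\<lambda>x. matrix_power (f x) n)"
  by (induction n)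
     (auto intro!: continuous_on_const bounded_bilinear.continuous_on[OF bounded_bilinear_matrix_mult] assms)

text \<open>Polynomial dependence on \<open>x\<close> reduces Gaussian integration by parts to the moments of the normal
distribution.\<close>

lemma inner_matrix_power_pencil_poly:
  fixes A Y :: "complex^'n^'n"
  shows "\<exists>P. \<forall>x. inner C (matrix_power (x *\<^sub>R A + Y) n) = poly P x"
proof (induction n arbitrary: C)
  case 0
  have "\<forall>x. inner C (matrix_power (x *\<^sub>R A + Y) 0) = poly [:inner C (mat 1):] x"
    by simp
  then show ?case
    by blast
next
  case (Suc n)
  obtain P Q where P: "\<And>x. inner (conj_transpose A ** C) (matrix_power (x *\<^sub>R A + Y) n) = poly P x"
    and Q: "\<And>x. inner (conj_transpose Y ** C) (matrix_power (x *\<^sub>R A + Y) n) = poly Q x"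
    using Suc by meson
  have "inner C (matrix_power (x *\<^sub>R A + Y) (Suc n)) = poly (pCons 0 P + Q) x" for x
    by (simp add: P[symmetric] Q[symmetric] matrix_mult_add_left matrix_mult_scaleR_left inner_add_right
        inner_matrix_mult_left)
  then show ?case
    by blast
qed

lemma inner_matrix_power_pencil_deriv:
  fixes A Y :: "complex^'n^'n"
  shows "((\<lambda>x. inner C (matrix_power (x *\<^sub>R A + Y) n)) has_real_derivative
     (\<Sum>q<n. inner C (matrix_power (x *\<^sub>R A + Y) q ** A ** matrix_power (x *\<^sub>R A + Y) (n - Suc q)))) (at x)"
  unfolding CARAT_DERIV
proof (intro exI conjI allI)
  let ?g = "\<lambda>z. \<Sum>q<n. inner C (matrix_power (z *\<^sub>R A + Y) q ** A ** matrix_power (x *\<^sub>R A + Y) (n - Suc q))"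
  show "inner C (matrix_power (z *\<^sub>R A + Y) n) - inner C (matrix_power (x *\<^sub>R A + Y) n) = ?g z * (z - x)" for z
  proof -
    have "(z *\<^sub>R A + Y) - (x *\<^sub>R A + Y) = (z - x) *\<^sub>R A"
      by (simp add: scaleR_diff_left)
    then show ?thesis
      unfolding inner_diff_right[symmetric] matrix_power_diff
      by (simp add: matrix_mult_scaleR_left matrix_mult_scaleR_right inner_sum_right sum_distrib_left mult.commute)
  qed
  have "continuous_on UNIV ?g"
    by (intro continuous_intros bounded_bilinear.continuous_on[OF bounded_bilinear_matrix_mult])
  then show "isCont ?g x"
    by (simp add: continuous_on_eq_continuous_at)
qed (rule refl)

lemma fact_double_Suc:
  "fact (2 * Suc k) / (2 ^ Suc k * fact (Suc k)) = (2 * real k + 1) * (fact (2 * k) / (2 ^ k * fact k) :: real)"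
proof -
  have "fact (2 * Suc k) = (2 * real k + 2) * (2 * real k + 1) * fact (2 * k)"
    by (simp add: algebra_simps)
  moreover have "(2::real) ^ Suc k * fact (Suc k) = (2 * real k + 2) * (2 ^ k * fact k)"
    by (simp add: algebra_simps)
  moreover have "2 * real k + 2 \<noteq> 0"
    by linarith
  ultimately show ?thesis
    by (simp only: mult.assoc mult_divide_mult_cancel_left times_divide_eq_right) simp
qed

abbreviation std_normal :: "real measure" where
  "std_normal \<equiv> density lborel std_normal_density"

lemma std_normal_power_moments:
  shows "integrable std_normal (\<lambda>x. x ^ n)"
    and "(\<integral>x. x ^ Suc n \<partial>std_normal) = real n * (\<integral>x. x ^ (n - 1) \<partial>std_normal)"
proof -
  have int: "(\<integral>x. x ^ n \<partial>std_normal) = (\<integral>x. std_normal_density x * x ^ n \<partial>lborel)" for n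
    by (subst integral_density) auto
  have even: "(\<integral>x. x ^ (2 * k) \<partial>std_normal) = fact (2 * k) / (2 ^ k * fact k)" for k
    unfolding int by (rule integral_std_normal_moment_even)
  have odd: "(\<integral>x. x ^ (2 * k + 1) \<partial>std_normal) = 0" for k
    unfolding int by (rule integral_std_normal_moment_odd)
  show "integrable std_normal (\<lambda>x. x ^ n)"
    using integrable_normal_moment[of 1 0 n] by (subst integrable_density) auto
  show "(\<integral>x. x ^ Suc n \<partial>std_normal) = real n * (\<integral>x. x ^ (n - 1) \<partial>std_normal)"
  proof (cases "even n")
    case True
    then obtain k where k: "n = 2 * k"
      by (auto elim: evenE)
    show ?thesis
    proof (cases k)
      case 0
      then show ?thesis
        using odd[of 0] k by simp
    next
      case (Suc j)
      then show ?thesis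
        using odd[of k] odd[of j] k by simp
    qed
  next
    case False
    then obtain k where k: "n = 2 * k + 1"
      by (auto elim: oddE)
    have "(\<integral>x. x ^ Suc n \<partial>std_normal) = fact (2 * Suc k) / (2 ^ Suc k * fact (Suc k))"
      using even[of "Suc k"] k by simp
    also have "\<dots> = real n * (fact (2 * k) / (2 ^ k * fact k))"
      unfolding k by (subst fact_double_Suc) simp
    finally show ?thesis
      unfolding even[symmetric] k by simp
  qed
qed

lemma integrable_std_normal_poly: "integrable std_normal (poly P)"
  unfolding poly_altdef
  by (intro Bochner_Integration.integrable_sum integrable_mult_right std_normal_power_moments)

text \<open>Stein's identity for polynomials: on monomials it is the moment recursion.\<close>

lemma std_normal_stein_poly:
  "(\<integral>x. x * poly P x \<partial>std_normal) = (\<integral>x. poly (pderiv P) x \<partial>std_normal)"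
proof -
  note [simp] = std_normal_power_moments(1)
  have "x * poly P x = (\<Sum>i\<le>degree P. coeff P i * x ^ Suc i)" for x
    by (simp add: poly_altdef sum_distrib_left mult_ac)
  then have "(\<integral>x. x * poly P x \<partial>std_normal) = (\<Sum>i\<le>degree P. coeff P i * (\<integral>x. x ^ Suc i \<partial>std_normal))"
    by (simp del: power_Suc)
  also have "\<dots> = (\<Sum>i\<le>degree P. coeff P i * (real i * (\<integral>x. x ^ (i - 1) \<partial>std_normal)))"
    unfolding std_normal_power_moments(2) ..
  also have "\<dots> = (\<integral>x. (\<Sum>i\<le>degree P. coeff P i * (real i * x ^ (i - 1))) \<partial>std_normal)"
    by simp
  also have "(\<lambda>x. \<Sum>i\<le>degree P. coeff P i * (real i * x ^ (i - 1))) = poly (pderiv P)"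
  proof
    fix x
    have "pderiv P = pderiv (\<Sum>i\<le>degree P. monom (coeff P i) i)"
      by (simp add: poly_as_sum_of_monoms)
    then show "(\<Sum>i\<le>degree P. coeff P i * (real i * x ^ (i - 1))) = poly (pderiv P) x"
      by (simp add: higher_pderiv_sum[of 1, simplified] pderiv_monom poly_sum poly_monom mult_ac)
  qed
  finally show ?thesis .
qed

text \<open>Stein's identity turns the second term of the gap into the expectation of a derivative, and the
product rule expresses this derivative by sandwiched products with equal outer matrices.\<close>

lemma std_normal_stein_gap_nonneg:
  assumes A: "hermitian A" and Y: "hermitian Y"
  shows "0 \<le> (\<integral>x. stein_gap A Y p x \<partial>std_normal)"
proof -
  obtain P where P: "\<And>x. inner A (matrix_power (x *\<^sub>R A + Y) (2 * p + 1)) = poly P x"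
    using inner_matrix_power_pencil_poly by meson
  obtain Q where Q: "\<And>x. inner (A ** A) (matrix_power (x *\<^sub>R A + Y) (2 * p)) = poly Q x"
    using inner_matrix_power_pencil_poly by meson
  have le: "poly (pderiv P) x \<le> (2 * real p + 1) * poly Q x" for x
  proof -
    have h: "hermitian (x *\<^sub>R A + Y)"
      by (intro hermitian_add hermitian_scaleR A Y)
    have "((\<lambda>x. poly P x) has_real_derivative
       (\<Sum>q<2*p+1. inner A (matrix_power (x *\<^sub>R A + Y) q ** A ** matrix_power (x *\<^sub>R A + Y) (2*p+1 - Suc q)))) (at x)"
      unfolding P[symmetric] by (rule inner_matrix_power_pencil_deriv)
    then have "poly (pderiv P) x =
       (\<Sum>q<2*p+1. inner A (matrix_power (x *\<^sub>R A + Y) q ** A ** matrix_power (x *\<^sub>R A + Y) (2*p+1 - Suc q)))"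
      using poly_DERIV[of P x] by (rule DERIV_unique[OF _, symmetric])
    also have "\<dots> \<le> (2 * real p + 1) * poly Q x"
      using sum_sandwich_le[OF A h h, of p] unfolding Q by simp
    finally show ?thesis .
  qed
  have intx: "integrable std_normal (\<lambda>x. x * poly P x)"
    using integrable_std_normal_poly[of "[:0, 1:] * P"] by (rule Bochner_Integration.integrable_cong[THEN iffD1, rotated 2]) auto
  have "(\<integral>x. x * poly P x \<partial>std_normal) = (\<integral>x. poly (pderiv P) x \<partial>std_normal)"
    by (rule std_normal_stein_poly)
  also have "\<dots> \<le> (\<integral>x. (2 * real p + 1) * poly Q x \<partial>std_normal)"
    by (intro integral_mono le integrable_mult_right integrable_std_normal_poly)
  finally show ?thesis
    unfolding stein_gap_def P Q
    by (simp add: intx integrable_std_normal_poly)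
qed

lemma continuous_on_stein_gap [continuous_intros]: "continuous_on S (stein_gap A Y p)"
  unfolding stein_gap_def[abs_def] by (intro continuous_intros)

lemma borel_measurable_stein_gap [measurable]: "stein_gap A Y p \<in> borel_measurable borel"
  by (intro borel_measurable_continuous_onI continuous_on_stein_gap)

context prob_space begin

lemma std_normal_expectation:
  assumes X: "distributed M lborel X std_normal_density" and f[measurable]: "f \<in> borel_measurable borel"
  shows "(\<integral>\<omega>. f (X \<omega>) \<partial>M) = (\<integral>x. f x \<partial>std_normal)"
    and "integrable M (\<lambda>\<omega>. f (X \<omega>)) \<longleftrightarrow> integrable std_normal (f :: real \<Rightarrow> real)"
proof -
  have X_lborel[measurable]: "X \<in> measurable M lborel"
    by (rule distributed_measurable[OF X])
  show "(\<integral>\<omega>. f (X \<omega>) \<partial>M) = (\<integral>x. f x \<partial>std_normal)"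
    unfolding distributed_distr_eq_density[OF X, symmetric] by (subst integral_distr[OF X_lborel]) auto
  show "integrable M (\<lambda>\<omega>. f (X \<omega>)) \<longleftrightarrow> integrable std_normal (f :: real \<Rightarrow> real)"
    unfolding distributed_distr_eq_density[OF X, symmetric] by (subst integrable_distr_eq[OF X_lborel]) auto
qed

lemma std_normal_rv:
  assumes X: "distributed M lborel X std_normal_density"
  shows "integrable M (\<lambda>\<omega>. X \<omega> ^ n)" "(\<integral>\<omega>. X \<omega> \<partial>M) = 0" "(\<integral>\<omega>. X \<omega> ^ 2 \<partial>M) = 1"
    and "hermitian A \<Longrightarrow> hermitian Y \<Longrightarrow> 0 \<le> (\<integral>\<omega>. stein_gap A Y p (X \<omega>) \<partial>M)"
proof -
  interpret N: prob_space std_normal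
    by (rule prob_space_normal_density) simp
  show "integrable M (\<lambda>\<omega>. X \<omega> ^ n)"
    by (subst std_normal_expectation(2)[OF X]) (auto intro: std_normal_power_moments)
  show "(\<integral>\<omega>. X \<omega> \<partial>M) = 0" 
    using std_normal_power_moments(2)[of 0] by (subst std_normal_expectation(1)[OF X]) auto
  show "(\<integral>\<omega>. X \<omega> ^ 2 \<partial>M) = 1"
    using std_normal_power_moments(2)[of 1] N.prob_space
    by (subst std_normal_expectation(1)[OF X]) (auto simp: power2_eq_square)
  show "0 \<le> (\<integral>\<omega>. stein_gap A Y p (X \<omega>) \<partial>M)" if "hermitian A" "hermitian Y"
    using std_normal_stein_gap_nonneg[OF that, of p] by (subst std_normal_expectation(1)[OF X]) auto
qed

lemma rademacher_expectation:
  fixes f :: "real \<Rightarrow> real"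
  assumes X: "rademacher M X" and f[measurable]: "f \<in> borel_measurable borel"
  shows "integrable M (\<lambda>\<omega>. f (X \<omega>))" "(\<integral>\<omega>. f (X \<omega>) \<partial>M) = (f 1 + f (- 1)) / 2"
proof -
  have [measurable]: "random_variable borel X"
    using X by (simp add: rademacher_def)
  define P Q where "P = {\<omega> \<in> space M. X \<omega> = 1}" and "Q = {\<omega> \<in> space M. X \<omega> = - 1}"
  have PQ[measurable]: "P \<in> events" "Q \<in> events" and disj: "P \<inter> Q = {}"
    by (auto simp: P_def Q_def)
  have prob: "prob P = 1 / 2" "prob Q = 1 / 2"
    using X by (simp_all add: rademacher_def P_def Q_def)
  have "prob (P \<union> Q) = 1"
    using finite_measure_Union[OF PQ disj] prob by simp
  then have "AE \<omega> in M. \<omega> \<in> P \<union> Q"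
    using prob_eq_1[of "P \<union> Q"] PQ by simp
  then have AE: "AE \<omega> in M. f (X \<omega>) = f 1 * indicator P \<omega> + f (- 1) * indicator Q \<omega>"
    by eventually_elim (auto simp: P_def Q_def indicator_def)
  have int: "integrable M (\<lambda>\<omega>. f 1 * indicator P \<omega> + f (- 1) * indicator Q \<omega>)"
    by (auto intro!: Bochner_Integration.integrable_add integrable_mult_right simp: emeasure_eq_measure)
  show "integrable M (\<lambda>\<omega>. f (X \<omega>))"
    using int by (subst integrable_cong_AE[OF _ _ AE]) auto
  have "(\<integral>\<omega>. f (X \<omega>) \<partial>M) = (\<integral>\<omega>. f 1 * indicator P \<omega> + f (- 1) * indicator Q \<omega> \<partial>M)"
    by (intro integral_cong_AE AE) auto
  also have "\<dots> = f 1 * prob P + f (- 1) * prob Q"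
    by (subst Bochner_Integration.integral_add) (auto simp: emeasure_eq_measure)
  finally show "(\<integral>\<omega>. f (X \<omega>) \<partial>M) = (f 1 + f (- 1)) / 2"
    by (simp add: prob)
qed

lemma rademacher_rv:
  assumes X: "rademacher M X"
  shows "integrable M (\<lambda>\<omega>. X \<omega> ^ n)" "(\<integral>\<omega>. X \<omega> \<partial>M) = 0" "(\<integral>\<omega>. X \<omega> ^ 2 \<partial>M) = 1"
    and "hermitian A \<Longrightarrow> hermitian Y \<Longrightarrow> 0 \<le> (\<integral>\<omega>. stein_gap A Y p (X \<omega>) \<partial>M)"
proof -
  show "integrable M (\<lambda>\<omega>. X \<omega> ^ n)"
    by (rule rademacher_expectation[OF X]) auto
  show "(\<integral>\<omega>. X \<omega> \<partial>M) = 0" "(\<integral>\<omega>. X \<omega> ^ 2 \<partial>M) = 1"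
    by (subst rademacher_expectation[OF X]; simp)+
  show "0 \<le> (\<integral>\<omega>. stein_gap A Y p (X \<omega>) \<partial>M)" if "hermitian A" "hermitian Y"
    using stein_gap_symmetric_nonneg[OF that, of p]
    by (subst rademacher_expectation[OF X]) auto
qed

end

section \<open>Moment recursion for Hermitian series\<close>

context prob_space begin

text \<open>Fubini's theorem in the form needed to use the one-variable inequality: under independence the joint
law is a product, so it is enough that the partial expectation over a single coordinate is
nonnegative whatever the values of the others.\<close>

lemma expectation_nonneg_by_coordinate:
  fixes F :: "('k \<Rightarrow> real) \<Rightarrow> real" and \<xi> :: "'k \<Rightarrow> 'a \<Rightarrow> real"
  assumes indep: "indep_vars (\<lambda>_. borel) \<xi> K" and K: "finite K" "k \<in> K"
    and F: "F \<in> borel_measurable (PiM K (\<lambda>_. borel))"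
    and int: "integrable M (\<lambda>\<omega>. F (\<lambda>j\<in>K. \<xi> j \<omega>))"
    and nonneg: "\<And>x. 0 \<le> (\<integral>\<omega>. F (x(k := \<xi> k \<omega>)) \<partial>M)"
  shows "0 \<le> (\<integral>\<omega>. F (\<lambda>j\<in>K. \<xi> j \<omega>) \<partial>M)"
proof -
  \<comment> \<open>Coefficients outside \<open>K\<close> are arbitrary functions; zero replaces them so that every factor of the
      product is a probability measure.\<close>
  define \<eta> where "\<eta> j = (if j \<in> K then \<xi> j else (\<lambda>_. 0))" for j
  define \<mu> where "\<mu> j = distr M borel (\<eta> j)" for j
  have rv: "random_variable borel (\<xi> j)" if "j \<in> K" for j
    using indep that by (simp add: indep_vars_def)
  have rv\<eta>[measurable]: "random_variable borel (\<eta> j)" for j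
    using rv by (simp add: \<eta>_def)
  interpret \<mu>: product_prob_space \<mu> K
    by (intro product_prob_spaceI) (simp add: \<mu>_def prob_space_distr)
  have joint[measurable]: "(\<lambda>\<omega>. \<lambda>j\<in>K. \<xi> j \<omega>) \<in> measurable M (PiM K (\<lambda>_. borel))"
    by (intro measurable_restrict rv)
  have "distr M (PiM K (\<lambda>_. borel)) (\<lambda>\<omega>. \<lambda>j\<in>K. \<xi> j \<omega>) = PiM K (\<lambda>j. distr M borel (\<xi> j))"
    using indep_vars_iff_distr_eq_PiM'[where I = K and X = \<xi> and M' = "\<lambda>_. borel"] indep rv K(2) by auto
  also have "\<dots> = PiM K \<mu>"
    by (intro PiM_cong) (simp_all add: \<mu>_def \<eta>_def)
  finally have distr: "distr M (PiM K (\<lambda>_. borel)) (\<lambda>\<omega>. \<lambda>j\<in>K. \<xi> j \<omega>) = PiM K \<mu>" .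
  have K_eq: "insert k (K - {k}) = K"
    using K(2) by auto
  have "(\<integral>\<omega>. F (\<lambda>j\<in>K. \<xi> j \<omega>) \<partial>M) = (\<integral>x. F x \<partial>PiM K \<mu>)"
    unfolding distr[symmetric] by (rule integral_distr[symmetric]) (use F in measurable)
  also have "\<dots> = (\<integral>x. (\<integral>y. F (x(k := y)) \<partial>\<mu> k) \<partial>PiM (K - {k}) \<mu>)"
  proof -
    have "integrable (PiM K \<mu>) F"
      unfolding distr[symmetric] using int by (subst integrable_distr_eq) (use F in measurable)
    then show ?thesis
      using \<mu>.product_integral_insert[of "K - {k}" k F] K(1) unfolding K_eq by simp
  qed
  also have "\<dots> = (\<integral>x. (\<integral>\<omega>. F (x(k := \<xi> k \<omega>)) \<partial>M) \<partial>PiM (K - {k}) \<mu>)"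
  proof (intro Bochner_Integration.integral_cong refl)
    fix x assume x: "x \<in> space (PiM (K - {k}) \<mu>)"
    have x': "x \<in> space (PiM (K - {k}) (\<lambda>_. borel))"
      using x by (simp add: space_PiM \<mu>_def)
    have "(\<lambda>y. F (x(k := y))) \<in> borel_measurable borel"
      using measurable_comp[OF measurable_component_update[OF x'], of k F borel] F
      unfolding K_eq by (simp add: comp_def)
    then show "(\<integral>y. F (x(k := y)) \<partial>\<mu> k) = (\<integral>\<omega>. F (x(k := \<xi> k \<omega>)) \<partial>M)"
      unfolding \<mu>_def using K(2) rv\<eta>[of k] by (subst integral_distr) (auto simp: \<eta>_def)
  qed
  also have "\<dots> \<ge> 0"
    by (intro Bochner_Integration.integral_nonneg nonneg)
  finally show ?thesis .
qed

end

lemma sum_power_le_sum_powers: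
  fixes a :: "'k \<Rightarrow> real"
  assumes K: "finite K" "K \<noteq> {}" and a: "\<And>k. k \<in> K \<Longrightarrow> 0 \<le> a k"
  shows "(\<Sum>k\<in>K. a k) ^ n \<le> real (card K) ^ n * (\<Sum>k\<in>K. a k ^ n)"
proof -
  have "Max (a ` K) \<in> a ` K"
    using K by (intro Max_in) auto
  then obtain m where m: "m \<in> K" "Max (a ` K) = a m"
    by (metis (no_types, lifting) imageE)
  have "a k \<le> a m" if "k \<in> K" for k
    using Max_ge[of "a ` K" "a k"] K that m by simp
  then have "(\<Sum>k\<in>K. a k) \<le> real (card K) * a m"
    using sum_bounded_above[of K a "a m"] by simp
  then have "(\<Sum>k\<in>K. a k) ^ n \<le> (real (card K) * a m) ^ n"
    using a by (intro power_mono sum_nonneg) auto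
  also have "\<dots> \<le> real (card K) ^ n * (\<Sum>k\<in>K. a k ^ n)"
    unfolding power_mult_distrib
    using m(1) K a by (intro mult_left_mono member_le_sum) auto
  finally show ?thesis .
qed

context prob_space begin

lemma integrable_norm_random_sum_power:
  fixes A :: "'k \<Rightarrow> 'b::{euclidean_space}"
  assumes K: "finite K"
    and rv: "\<And>k. k \<in> K \<Longrightarrow> random_variable borel (\<xi> k)"
    and mom: "\<And>k n. k \<in> K \<Longrightarrow> integrable M (\<lambda>\<omega>. \<xi> k \<omega> ^ n)"
  shows "integrable M (\<lambda>\<omega>. norm (\<Sum>k\<in>K. \<xi> k \<omega> *\<^sub>R A k) ^ n)"
proof (cases "K = {}")
  case False
  have int: "integrable M (\<lambda>\<omega>. real (card K) ^ n * (\<Sum>k\<in>K. \<bar>\<xi> k \<omega> ^ n\<bar> * norm (A k) ^ n))"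
    by (intro integrable_mult_right Bochner_Integration.integrable_sum integrable_mult_left integrable_abs mom)
  have [measurable]: "random_variable borel (\<lambda>\<omega>. \<Sum>k\<in>K. \<xi> k \<omega> *\<^sub>R A k)"
    by (intro borel_measurable_sum borel_measurable_scaleR rv) auto
  show ?thesis
  proof (rule Bochner_Integration.integrable_bound[OF int])
    show "AE \<omega> in M. norm (norm (\<Sum>k\<in>K. \<xi> k \<omega> *\<^sub>R A k) ^ n)
        \<le> norm (real (card K) ^ n * (\<Sum>k\<in>K. \<bar>\<xi> k \<omega> ^ n\<bar> * norm (A k) ^ n))"
    proof (rule AE_I2)
      fix \<omega>
      have "norm (\<Sum>k\<in>K. \<xi> k \<omega> *\<^sub>R A k) ^ n \<le> (\<Sum>k\<in>K. \<bar>\<xi> k \<omega>\<bar> * norm (A k)) ^ n"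
        by (intro power_mono sum_norm_le) auto
      also have "\<dots> \<le> real (card K) ^ n * (\<Sum>k\<in>K. (\<bar>\<xi> k \<omega>\<bar> * norm (A k)) ^ n)"
        by (intro sum_power_le_sum_powers K False) auto
      finally show "norm (norm (\<Sum>k\<in>K. \<xi> k \<omega> *\<^sub>R A k) ^ n)
        \<le> norm (real (card K) ^ n * (\<Sum>k\<in>K. \<bar>\<xi> k \<omega> ^ n\<bar> * norm (A k) ^ n))"
        by (simp add: power_mult_distrib power_abs)
    qed
  qed measurable
qed simp

lemma borel_measurable_matrix_power [measurable (raw)]:
  "f \<in> borel_measurable N \<Longrightarrow> (\<lambda>x. matrix_power (f x) n) \<in> borel_measurable N"
  by (rule borel_measurable_continuous_on) (intro continuous_intros continuous_on_id)

text \<open>The trace moments \<open>m\<^sub>p = E tr X\<^sup>2\<^sup>p\<close> satisfy \<open>m\<^sub>p\<^sub>+\<^sub>1 \<le> (2 p + 1) v m\<^sub>p\<close>. One factor \<open>X\<close> of the power is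
expanded into the sum \<open>\<Sum> \<xi>\<^sub>k A\<^sub>k\<close>, the one-variable inequality is applied to each coordinate \<open>\<xi>\<^sub>k\<close> with
the rest of the series as \<open>Y\<close>, and the resulting matrices \<open>A\<^sub>k\<^sup>2\<close> recombine into their sum, which is
bounded by \<open>v\<close>.\<close>

lemma hermitian_series_moment_step:
  fixes A :: "'k \<Rightarrow> complex^'n^'n"
  assumes K: "finite K"
    and indep: "indep_vars (\<lambda>_. borel) \<xi> K"
    and mom: "\<And>k n. k \<in> K \<Longrightarrow> integrable M (\<lambda>\<omega>. \<xi> k \<omega> ^ n)"
    and A: "\<And>k. k \<in> K \<Longrightarrow> hermitian (A k)"
    and stein: "\<And>k Y p. k \<in> K \<Longrightarrow> hermitian Y \<Longrightarrow> 0 \<le> (\<integral>\<omega>. stein_gap (A k) Y p (\<xi> k \<omega>) \<partial>M)"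
    and v: "\<And>x. inner ((\<Sum>k\<in>K. A k ** A k) *v x) x \<le> v * (norm x)\<^sup>2"
  defines "X \<equiv> (\<lambda>\<omega>. \<Sum>k\<in>K. \<xi> k \<omega> *\<^sub>R A k)"
  shows "integrable M (\<lambda>\<omega>. (norm (matrix_power (X \<omega>) p))\<^sup>2)"
    and "(\<integral>\<omega>. (norm (matrix_power (X \<omega>) (Suc p)))\<^sup>2 \<partial>M)
       \<le> (2 * real p + 1) * v * (\<integral>\<omega>. (norm (matrix_power (X \<omega>) p))\<^sup>2 \<partial>M)"
proof -
  have rv[measurable]: "random_variable borel (\<xi> k)" if "k \<in> K" for k
    using indep that by (simp add: indep_vars_def)
  have X[measurable]: "random_variable borel X"
    unfolding X_def by (intro borel_measurable_sum borel_measurable_scaleR rv) auto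
  have hX: "hermitian (X \<omega>)" for \<omega>
    unfolding X_def by (intro hermitian_sum hermitian_scaleR A)
  have normX: "integrable M (\<lambda>\<omega>. norm (X \<omega>) ^ n)" for n
    unfolding X_def by (intro integrable_norm_random_sum_power K rv mom)
  have int: "integrable M (\<lambda>\<omega>. inner C (matrix_power (X \<omega>) n))" for C n
  proof -
    obtain c where c: "\<And>A :: complex^'n^'n. norm (matrix_power A n) \<le> c * norm A ^ n" "0 \<le> c"
      by (rule norm_matrix_power_le) blast
    have bound: "integrable M (\<lambda>\<omega>. norm C * c * norm (X \<omega>) ^ n)"
      by (intro integrable_mult_right normX)
    show ?thesis
    proof (rule Bochner_Integration.integrable_bound[OF bound])
      show "AE \<omega> in M. norm (inner C (matrix_power (X \<omega>) n)) \<le> norm (norm C * c * norm (X \<omega>) ^ n)"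
      proof (rule AE_I2)
        fix \<omega>
        have "norm (inner C (matrix_power (X \<omega>) n)) \<le> norm C * norm (matrix_power (X \<omega>) n)"
          using Cauchy_Schwarz_ineq2 by simp
        also have "\<dots> \<le> norm C * (c * norm (X \<omega>) ^ n)"
          by (intro mult_left_mono c) simp
        finally show "norm (inner C (matrix_power (X \<omega>) n)) \<le> norm (norm C * c * norm (X \<omega>) ^ n)"
          using c(2) by (simp add: mult.assoc)
      qed
    qed measurable
  qed
  have int2: "integrable M (\<lambda>\<omega>. \<xi> k \<omega> * inner C (matrix_power (X \<omega>) n))" if "k \<in> K" for k C n
  proof -
    have [measurable]: "random_variable borel (\<xi> k)"
      by (rule rv[OF that])
    obtain c where c: "\<And>A :: complex^'n^'n. norm (matrix_power A n) \<le> c * norm A ^ n" "0 \<le> c"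
      by (rule norm_matrix_power_le) blast
    have bound: "integrable M (\<lambda>\<omega>. \<xi> k \<omega> ^ 2 + (norm C * c)\<^sup>2 * norm (X \<omega>) ^ (2 * n))"
      by (intro Bochner_Integration.integrable_add integrable_mult_right normX mom that)
    have "AE \<omega> in M. norm (\<xi> k \<omega> * inner C (matrix_power (X \<omega>) n))
        \<le> norm (\<xi> k \<omega> ^ 2 + (norm C * c)\<^sup>2 * norm (X \<omega>) ^ (2 * n))"
    proof (rule AE_I2)
      fix \<omega>
      have "\<bar>inner C (matrix_power (X \<omega>) n)\<bar> \<le> norm C * norm (matrix_power (X \<omega>) n)"
        by (rule Cauchy_Schwarz_ineq2)
      also have "\<dots> \<le> norm C * (c * norm (X \<omega>) ^ n)"
        by (intro mult_left_mono c) simp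
      finally have "\<bar>inner C (matrix_power (X \<omega>) n)\<bar> \<le> norm C * c * norm (X \<omega>) ^ n"
        by (simp add: mult.assoc)
      then have "\<bar>\<xi> k \<omega>\<bar> * \<bar>inner C (matrix_power (X \<omega>) n)\<bar> \<le> \<bar>\<xi> k \<omega>\<bar> * (norm C * c * norm (X \<omega>) ^ n)"
        by (intro mult_left_mono) auto
      also have "\<dots> \<le> \<bar>\<xi> k \<omega>\<bar>\<^sup>2 + (norm C * c * norm (X \<omega>) ^ n)\<^sup>2"
      proof -
        have "0 \<le> \<bar>\<xi> k \<omega>\<bar> * (norm C * c * norm (X \<omega>) ^ n)"
          using c(2) by simp
        then show ?thesis
          using sum_squares_bound[of "\<bar>\<xi> k \<omega>\<bar>" "norm C * c * norm (X \<omega>) ^ n"] by linarith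
      qed
      also have "\<dots> = \<xi> k \<omega> ^ 2 + (norm C * c)\<^sup>2 * norm (X \<omega>) ^ (2 * n)"
        by (simp add: power_mult_distrib power_mult[symmetric] mult.commute)
      finally show "norm (\<xi> k \<omega> * inner C (matrix_power (X \<omega>) n))
        \<le> norm (\<xi> k \<omega> ^ 2 + (norm C * c)\<^sup>2 * norm (X \<omega>) ^ (2 * n))"
        by (simp add: abs_mult)
    qed
    then show ?thesis
      by (rule Bochner_Integration.integrable_bound[OF bound, rotated]) measurable
  qed
  show int0: "integrable M (\<lambda>\<omega>. (norm (matrix_power (X \<omega>) p))\<^sup>2)" for p
    unfolding norm_matrix_power_sq[OF hX] by (rule int)
  define V where "V = (\<Sum>k\<in>K. A k ** A k)"
  have gap: "0 \<le> (\<integral>\<omega>. (2 * real p + 1) * inner (A k ** A k) (matrix_power (X \<omega>) (2 * p))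
        - \<xi> k \<omega> * inner (A k) (matrix_power (X \<omega>) (2 * p + 1)) \<partial>M)" if k: "k \<in> K" for k
  proof -
    define S where "S x = (\<Sum>j\<in>K. x j *\<^sub>R A j)" for x :: "'k \<Rightarrow> real"
    define F where "F x = (2 * real p + 1) * inner (A k ** A k) (matrix_power (S x) (2 * p))
        - x k * inner (A k) (matrix_power (S x) (2 * p + 1))" for x
    have FX: "F (\<lambda>j\<in>K. \<xi> j \<omega>) = (2 * real p + 1) * inner (A k ** A k) (matrix_power (X \<omega>) (2 * p))
        - \<xi> k \<omega> * inner (A k) (matrix_power (X \<omega>) (2 * p + 1))" for \<omega>
      using k by (simp add: F_def S_def X_def cong: sum.cong)
    have "0 \<le> (\<integral>\<omega>. F (\<lambda>j\<in>K. \<xi> j \<omega>) \<partial>M)"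
    proof (rule expectation_nonneg_by_coordinate[OF indep K k])
      have S[measurable]: "S \<in> borel_measurable (PiM K (\<lambda>_. borel))"
        unfolding S_def by (intro borel_measurable_sum borel_measurable_scaleR measurable_component_singleton) auto
      have [measurable]: "(\<lambda>x. x k) \<in> borel_measurable (PiM K (\<lambda>_. borel))"
        by (rule measurable_component_singleton[OF k])
      show "F \<in> borel_measurable (PiM K (\<lambda>_. borel))"
        unfolding F_def by measurable
      show "integrable M (\<lambda>\<omega>. F (\<lambda>j\<in>K. \<xi> j \<omega>))"
        unfolding FX by (intro Bochner_Integration.integrable_diff integrable_mult_right int int2 k)
      fix x :: "'k \<Rightarrow> real"
      \<comment> \<open>The part of the series held fixed while only the coefficient of \<open>A k\<close> varies.\<close>
      define Y where "Y = (\<Sum>j\<in>K - {k}. x j *\<^sub>R A j)"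
      have "S (x(k := y)) = y *\<^sub>R A k + Y" for y
        unfolding S_def Y_def sum.remove[OF K k] by simp
      then have "F (x(k := y)) = stein_gap (A k) Y p y" for y
        by (simp add: F_def stein_gap_def)
      moreover have "hermitian Y"
        unfolding Y_def by (intro hermitian_sum hermitian_scaleR A) auto
      ultimately show "0 \<le> (\<integral>\<omega>. F (x(k := \<xi> k \<omega>)) \<partial>M)"
        using stein[OF k] by simp
    qed
    then show ?thesis
      unfolding FX .
  qed
  have eq: "(\<Sum>k\<in>K. (2 * real p + 1) * inner (A k ** A k) (matrix_power (X \<omega>) (2 * p))
        - \<xi> k \<omega> * inner (A k) (matrix_power (X \<omega>) (2 * p + 1))) =
      (2 * real p + 1) * inner V (matrix_power (X \<omega>) (2 * p)) - (norm (matrix_power (X \<omega>) (Suc p)))\<^sup>2" for \<omega>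
  proof -
    have "(norm (matrix_power (X \<omega>) (Suc p)))\<^sup>2 = inner (mat 1) (X \<omega> ** matrix_power (X \<omega>) (2 * p + 1))"
      unfolding norm_matrix_power_sq[OF hX] by simp
    also have "\<dots> = inner (X \<omega>) (matrix_power (X \<omega>) (2 * p + 1))"
      using inner_matrix_mult_left[of "X \<omega>" "mat 1"] hX[of \<omega>] by (simp add: hermitian_def del: matrix_power.simps)
    also have "\<dots> = (\<Sum>k\<in>K. \<xi> k \<omega> * inner (A k) (matrix_power (X \<omega>) (2 * p + 1)))"
      unfolding X_def inner_sum_left inner_scaleR_left ..
    finally show ?thesis
      by (simp add: sum_subtractf V_def inner_sum_left sum_distrib_left)
  qed
  have "0 \<le> (\<Sum>k\<in>K. \<integral>\<omega>. (2 * real p + 1) * inner (A k ** A k) (matrix_power (X \<omega>) (2 * p))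
        - \<xi> k \<omega> * inner (A k) (matrix_power (X \<omega>) (2 * p + 1)) \<partial>M)"
    by (intro sum_nonneg gap)
  also have "\<dots> = (\<integral>\<omega>. (2 * real p + 1) * inner V (matrix_power (X \<omega>) (2 * p))
      - (norm (matrix_power (X \<omega>) (Suc p)))\<^sup>2 \<partial>M)"
    unfolding eq[symmetric]
    by (intro Bochner_Integration.integral_sum[symmetric] Bochner_Integration.integrable_diff
        integrable_mult_right int int2)
  also have "\<dots> = (2 * real p + 1) * (\<integral>\<omega>. inner V (matrix_power (X \<omega>) (2 * p)) \<partial>M)
      - (\<integral>\<omega>. (norm (matrix_power (X \<omega>) (Suc p)))\<^sup>2 \<partial>M)"
    by (subst Bochner_Integration.integral_diff) (intro integrable_mult_right int int0, rule int0, simp)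
  finally have "(\<integral>\<omega>. (norm (matrix_power (X \<omega>) (Suc p)))\<^sup>2 \<partial>M)
      \<le> (2 * real p + 1) * (\<integral>\<omega>. inner V (matrix_power (X \<omega>) (2 * p)) \<partial>M)"
    by simp
  also have "\<dots> \<le> (2 * real p + 1) * (\<integral>\<omega>. v * (norm (matrix_power (X \<omega>) p))\<^sup>2 \<partial>M)"
  proof (intro mult_left_mono integral_mono int integrable_mult_right int0)
    fix \<omega>
    have "inner V (matrix_power (X \<omega>) (2 * p)) = inner (V ** matrix_power (X \<omega>) p) (matrix_power (X \<omega>) p)"
      using hermitian_matrix_power[OF hX, of \<omega> p]
      by (simp add: inner_matrix_mult_right hermitian_def mult_2 matrix_power_add)
    also have "\<dots> \<le> v * (norm (matrix_power (X \<omega>) p))\<^sup>2"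
      using v unfolding V_def by (rule inner_mult_le_quadratic_form)
    finally show "inner V (matrix_power (X \<omega>) (2 * p)) \<le> v * (norm (matrix_power (X \<omega>) p))\<^sup>2" .
  qed auto
  finally show "(\<integral>\<omega>. (norm (matrix_power (X \<omega>) (Suc p)))\<^sup>2 \<partial>M)
       \<le> (2 * real p + 1) * v * (\<integral>\<omega>. (norm (matrix_power (X \<omega>) p))\<^sup>2 \<partial>M)"
    by (simp add: mult.assoc)
qed

text \<open>Iterating the step from \<open>tr 1 = CARD('n)\<close> produces the factor \<open>(2 p - 1)!! v\<^sup>p\<close>, that is, the moments
of a scalar Gaussian with variance \<open>v\<close>.\<close>

lemma hermitian_series_moment_bound:
  fixes A :: "'k \<Rightarrow> complex^'n^'n"
  assumes K: "finite K"
    and indep: "indep_vars (\<lambda>_. borel) \<xi> K"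
    and mom: "\<And>k n. k \<in> K \<Longrightarrow> integrable M (\<lambda>\<omega>. \<xi> k \<omega> ^ n)"
    and A: "\<And>k. k \<in> K \<Longrightarrow> hermitian (A k)"
    and stein: "\<And>k Y p. k \<in> K \<Longrightarrow> hermitian Y \<Longrightarrow> 0 \<le> (\<integral>\<omega>. stein_gap (A k) Y p (\<xi> k \<omega>) \<partial>M)"
    and v: "\<And>x. inner ((\<Sum>k\<in>K. A k ** A k) *v x) x \<le> v * (norm x)\<^sup>2" and v0: "0 \<le> v"
  shows "(\<integral>\<omega>. (norm (matrix_power (\<Sum>k\<in>K. \<xi> k \<omega> *\<^sub>R A k) p))\<^sup>2 \<partial>M)
     \<le> real CARD('n) * (fact (2 * p) / (2 ^ p * fact p) * v ^ p)"
proof (induction p)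
  case 0
  then show ?case
    by (simp add: norm_mat_1_sq prob_space)
next
  case (Suc p)
  have "(2 * real p + 1) * v * (real CARD('n) * (fact (2 * p) / (2 ^ p * fact p) * v ^ p))
      = real CARD('n) * (fact (2 * Suc p) / (2 ^ Suc p * fact (Suc p)) * v ^ Suc p)"
    unfolding fact_double_Suc by simp
  moreover have "(2 * real p + 1) * v * (\<integral>\<omega>. (norm (matrix_power (\<Sum>k\<in>K. \<xi> k \<omega> *\<^sub>R A k) p))\<^sup>2 \<partial>M)
     \<le> (2 * real p + 1) * v * (real CARD('n) * (fact (2 * p) / (2 ^ p * fact p) * v ^ p))"
    using v0 by (intro mult_left_mono Suc) auto
  ultimately show ?case
    using hermitian_series_moment_step(2)[OF K indep mom A stein v, of p] by simp
qed

end

section \<open>From moments to expectation and tail bounds\<close>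

text \<open>For positive \<open>v\<close> the bound is optimized at \<open>\<theta> = sqrt (2 ln d / v)\<close>. For \<open>v = 0\<close> a large \<open>\<theta>\<close> excludes
positive \<open>m\<close>.\<close>

lemma le_sqrt_of_quadratic_bounds:
  fixes m v d :: real
  assumes d: "1 < d" and v: "0 \<le> v"
    and bound: "\<And>\<theta>. 0 < \<theta> \<Longrightarrow> \<theta> * m \<le> ln d + \<theta>\<^sup>2 * v / 2"
  shows "m \<le> sqrt (2 * v * ln d)"
proof (cases "v = 0")
  case True
  have "m \<le> 0"
  proof (rule ccontr)
    assume "\<not> m \<le> 0"
    moreover have "0 < ln d"
      using d by simp
    ultimately have "(ln d + 1) / m * m \<le> ln d"
      using bound[of "(ln d + 1) / m"] True by simp
    with \<open>\<not> m \<le> 0\<close> show False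
      by simp
  qed
  with True show ?thesis
    by simp
next
  case False
  define s where "s = sqrt (2 * v * ln d)"
  have s: "0 < s" "s\<^sup>2 = 2 * v * ln d"
    using d v False by (simp_all add: s_def)
  have "s / v * m \<le> ln d + (s / v)\<^sup>2 * v / 2"
    using bound[of "s / v"] s(1) v False by simp
  also have "(s / v)\<^sup>2 * v / 2 = ln d"
    unfolding power_divide s(2) using False by (simp add: power2_eq_square)
  also have "ln d + ln d = s\<^sup>2 / v"
    using False by (simp add: s(2))
  finally have "s * m \<le> s * s"
    using v False by (simp add: field_simps power2_eq_square)
  then have "m \<le> s"
    using s(1) by simp
  then show ?thesis
    unfolding s_def .
qed

context prob_space begin

text \<open>The hyperbolic cosine involves even moments only, and its power series integrated term by term
is the series of \<open>D exp (\<theta>\<^sup>2 v / 2)\<close>, because \<open>(2 p - 1)!! / (2 p)! = 1 / (2\<^sup>p p!)\<close>.\<close>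

lemma exp_moment_from_even_moments:
  fixes N :: "'a \<Rightarrow> real"
  assumes [measurable]: "random_variable borel N"
    and int: "\<And>p. integrable M (\<lambda>\<omega>. N \<omega> ^ (2 * p))"
    and mom: "\<And>p. (\<integral>\<omega>. N \<omega> ^ (2 * p) \<partial>M) \<le> D * (fact (2 * p) / (2 ^ p * fact p) * v ^ p)"
  shows "integrable M (\<lambda>\<omega>. exp (\<theta> * N \<omega>))"
    and "(\<integral>\<omega>. exp (\<theta> * N \<omega>) \<partial>M) \<le> 2 * D * exp (\<theta>\<^sup>2 * v / 2)"
proof -
  define f where "f p \<omega> = (\<theta> * N \<omega>) ^ (2 * p) / fact (2 * p)" for p \<omega>
  have f_sums: "(\<lambda>p. f p \<omega>) sums cosh (\<theta> * N \<omega>)" for \<omega>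
  proof -
    have "(\<lambda>p. (\<lambda>n. if even n then (\<theta> * N \<omega>) ^ n /\<^sub>R fact n else 0) (2 * p)) sums cosh (\<theta> * N \<omega>)"
      by (subst sums_mono_reindex)
         (auto simp: strict_mono_def intro!: cosh_converges elim: evenE)
    then show ?thesis
      by (simp add: f_def divide_inverse mult.commute)
  qed
  have f0: "0 \<le> f p \<omega>" for p \<omega>
    by (simp add: f_def power_mult)
  have intf: "integrable M (f p)" for p
    using int[of p] by (simp add: f_def[abs_def] power_mult_distrib)
  have If: "(\<integral>\<omega>. f p \<omega> \<partial>M) \<le> D * ((\<theta>\<^sup>2 * v / 2) ^ p /\<^sub>R fact p)" for p
  proof -
    have "(\<integral>\<omega>. f p \<omega> \<partial>M) = \<theta> ^ (2 * p) / fact (2 * p) * (\<integral>\<omega>. N \<omega> ^ (2 * p) \<partial>M)"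
      by (simp add: f_def power_mult_distrib)
    also have "\<dots> \<le> \<theta> ^ (2 * p) / fact (2 * p) * (D * (fact (2 * p) / (2 ^ p * fact p) * v ^ p))"
      by (intro mult_left_mono mom) (simp add: power_mult)
    also have "\<dots> = D * ((\<theta>\<^sup>2 * v / 2) ^ p /\<^sub>R fact p)"
    proof -
      have "(\<theta>\<^sup>2 * v / 2) ^ p = \<theta> ^ (2 * p) * v ^ p / 2 ^ p"
        by (simp only: power_mult power_mult_distrib power_divide)
      moreover have "x / f * (D * (f / (y * g) * z)) = D * ((x * z / y) /\<^sub>R g)"
        if "f \<noteq> 0" for x y z f g :: real
        using that by (cases "y = 0 \<or> g = 0") (auto simp: field_simps)
      ultimately show ?thesis
        by (simp only: fact_nonzero not_False_eq_True)
    qed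
    finally show ?thesis .
  qed
  have g_sums: "(\<lambda>p. D * ((\<theta>\<^sup>2 * v / 2) ^ p /\<^sub>R fact p)) sums (D * exp (\<theta>\<^sup>2 * v / 2))"
    by (intro sums_mult exp_converges)
  have summ: "summable (\<lambda>p. \<integral>\<omega>. f p \<omega> \<partial>M)"
    by (rule summable_comparison_test'[OF sums_summable[OF g_sums], where N = 0])
       (use If in \<open>simp add: abs_of_nonneg f0 Bochner_Integration.integral_nonneg\<close>)
  have norm_f: "norm (f p \<omega>) = f p \<omega>" for p \<omega>
    using f0 by simp
  have summ': "AE \<omega> in M. summable (\<lambda>p. norm (f p \<omega>))" "summable (\<lambda>p. \<integral>\<omega>. norm (f p \<omega>) \<partial>M)"
    unfolding norm_f using summ f_sums by (auto intro: sums_summable)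
  have cosh_eq: "(\<Sum>p. f p \<omega>) = cosh (\<theta> * N \<omega>)" for \<omega>
    using f_sums by (rule sums_unique[symmetric])
  have int_cosh: "integrable M (\<lambda>\<omega>. cosh (\<theta> * N \<omega>))"
    using integrable_suminf[OF intf summ'] unfolding cosh_eq .
  have "(\<integral>\<omega>. cosh (\<theta> * N \<omega>) \<partial>M) = (\<Sum>p. \<integral>\<omega>. f p \<omega> \<partial>M)"
    using integral_suminf[OF intf summ'] unfolding cosh_eq .
  also have "\<dots> \<le> D * exp (\<theta>\<^sup>2 * v / 2)"
    unfolding sums_unique[OF g_sums] by (intro suminf_le If summ sums_summable[OF g_sums])
  finally have cosh_le: "(\<integral>\<omega>. cosh (\<theta> * N \<omega>) \<partial>M) \<le> D * exp (\<theta>\<^sup>2 * v / 2)" .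
  have exp_le: "exp (\<theta> * N \<omega>) \<le> 2 * cosh (\<theta> * N \<omega>)" for \<omega>
    by (simp add: cosh_def)
  show int_exp: "integrable M (\<lambda>\<omega>. exp (\<theta> * N \<omega>))"
    by (rule Bochner_Integration.integrable_bound[OF integrable_mult_right[OF int_cosh, of 2]])
       (use exp_le in \<open>auto intro!: AE_I2 intro: order_trans\<close>)
  have "(\<integral>\<omega>. exp (\<theta> * N \<omega>) \<partial>M) \<le> (\<integral>\<omega>. 2 * cosh (\<theta> * N \<omega>) \<partial>M)"
    by (intro integral_mono int_exp integrable_mult_right int_cosh exp_le)
  then show "(\<integral>\<omega>. exp (\<theta> * N \<omega>) \<partial>M) \<le> 2 * D * exp (\<theta>\<^sup>2 * v / 2)"
    using cosh_le by simp
qed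

text \<open>Jensen's inequality for the exponential gives the expectation bound, and Chernoff's bound gives the
tail at \<open>\<theta> = t / v\<close>. For \<open>v = 0\<close> letting \<open>\<theta>\<close> tend to infinity in Chernoff's bound shows that the tail
vanishes.\<close>

lemma subgaussian_expectation_and_tail:
  fixes N :: "'a \<Rightarrow> real"
  assumes N[measurable]: "random_variable borel N" and N0: "\<And>\<omega>. 0 \<le> N \<omega>"
    and int: "\<And>\<theta>. integrable M (\<lambda>\<omega>. exp (\<theta> * N \<omega>))"
    and mgf: "\<And>\<theta>. (\<integral>\<omega>. exp (\<theta> * N \<omega>) \<partial>M) \<le> d * exp (\<theta>\<^sup>2 * v / 2)"
    and d: "1 < d" and v: "0 \<le> v"
  shows "integrable M N"
    and "(\<integral>\<omega>. N \<omega> \<partial>M) \<le> sqrt (2 * v * ln d)"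
    and "0 \<le> t \<Longrightarrow> measure M {\<omega> \<in> space M. t \<le> N \<omega>} \<le> d * exp (- t\<^sup>2 / (2 * v))"
    and "v = 0 \<Longrightarrow> 0 < t \<Longrightarrow> measure M {\<omega> \<in> space M. t \<le> N \<omega>} = 0"
proof -
  show intN: "integrable M N"
  proof (rule Bochner_Integration.integrable_bound[OF int[of 1]])
    show "AE \<omega> in M. norm (N \<omega>) \<le> norm (exp (1 * N \<omega>))"
    proof (rule AE_I2)
      fix \<omega>
      show "norm (N \<omega>) \<le> norm (exp (1 * N \<omega>))"
        using exp_ge_add_one_self[of "N \<omega>"] N0[of \<omega>] by (simp del: exp_ge_add_one_self)
    qed
  qed measurable
  define m where "m = (\<integral>\<omega>. N \<omega> \<partial>M)"
  have "\<theta> * m \<le> ln d + \<theta>\<^sup>2 * v / 2" if "0 < \<theta>" for \<theta>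
  proof -
    \<comment> \<open>Jensen's inequality: the exponential lies above its tangent at \<open>\<theta> m\<close>.\<close>
    have "exp (\<theta> * m) = (\<integral>\<omega>. exp (\<theta> * m) * (1 + (\<theta> * N \<omega> - \<theta> * m)) \<partial>M)"
      using intN by (simp add: prob_space m_def)
    also have "\<dots> \<le> (\<integral>\<omega>. exp (\<theta> * N \<omega>) \<partial>M)"
    proof (intro integral_mono int)
      show "integrable M (\<lambda>\<omega>. exp (\<theta> * m) * (1 + (\<theta> * N \<omega> - \<theta> * m)))"
        using intN by simp
      fix \<omega>
      have "exp (\<theta> * m) * (1 + (\<theta> * N \<omega> - \<theta> * m)) \<le> exp (\<theta> * m) * exp (\<theta> * N \<omega> - \<theta> * m)"
        by (intro mult_left_mono exp_ge_add_one_self) simp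
      then show "exp (\<theta> * m) * (1 + (\<theta> * N \<omega> - \<theta> * m)) \<le> exp (\<theta> * N \<omega>)"
        by (simp add: exp_add[symmetric])
    qed
    also have "\<dots> \<le> d * exp (\<theta>\<^sup>2 * v / 2)"
      by (rule mgf)
    also have "\<dots> = exp (ln d + \<theta>\<^sup>2 * v / 2)"
      using d by (simp add: exp_add)
    finally show ?thesis
      by simp
  qed
  then show "(\<integral>\<omega>. N \<omega> \<partial>M) \<le> sqrt (2 * v * ln d)"
    unfolding m_def using le_sqrt_of_quadratic_bounds d v by blast
  have chernoff: "measure M {\<omega> \<in> space M. t \<le> N \<omega>} \<le> d * exp (\<theta>\<^sup>2 * v / 2 - \<theta> * t)" if "0 < \<theta>" for \<theta> t
  proof -
    have "measure M {\<omega> \<in> space M. t \<le> N \<omega>} \<le> exp (- \<theta> * t) * (\<integral>\<omega>\<in>space M. exp (\<theta> * N \<omega>) \<partial>M)"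
      by (intro Chernoff_ineq_ge that) (unfold set_integrable_def, rule integrable_mult_indicator, auto intro: int)
    also have "(\<integral>\<omega>\<in>space M. exp (\<theta> * N \<omega>) \<partial>M) = (\<integral>\<omega>. exp (\<theta> * N \<omega>) \<partial>M)"
      by (rule set_integral_space) (rule int)
    also have "exp (- \<theta> * t) * \<dots> \<le> exp (- \<theta> * t) * (d * exp (\<theta>\<^sup>2 * v / 2))"
      by (intro mult_left_mono mgf) simp
    also have "\<dots> = d * exp (\<theta>\<^sup>2 * v / 2 - \<theta> * t)"
      by (simp add: exp_add[symmetric] algebra_simps)
    finally show ?thesis .
  qed
  show "measure M {\<omega> \<in> space M. t \<le> N \<omega>} \<le> d * exp (- t\<^sup>2 / (2 * v))" if t: "0 \<le> t"
  proof (cases "t = 0 \<or> v = 0")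
    case True
    \<comment> \<open>The quotient vanishes for \<open>v = 0\<close> too, where it is a division by zero.\<close>
    then have "d * exp (- t\<^sup>2 / (2 * v)) = d"
      by auto
    then show ?thesis
      using d prob_le_1[of "{\<omega> \<in> space M. t \<le> N \<omega>}"] by linarith
  next
    case False
    have "(t / v)\<^sup>2 * v / 2 - t / v * t = - t\<^sup>2 / (2 * v)"
      using False by (simp add: field_simps power2_eq_square)
    then show ?thesis
      using chernoff[of "t / v" t] False t v by simp
  qed
  show "measure M {\<omega> \<in> space M. t \<le> N \<omega>} = 0" if "v = 0" "0 < t"
  proof -
    have "((\<lambda>\<theta>. d * exp (- (\<theta> * t))) \<longlongrightarrow> d * 0) at_top"
      by (intro tendsto_mult tendsto_const filterlim_compose[OF exp_at_bot]
          filterlim_compose[OF filterlim_uminus_at_bot_at_top]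
          filterlim_at_top_mult_tendsto_pos[OF tendsto_const] filterlim_ident that)
    moreover have "\<forall>\<^sub>F \<theta> in at_top. measure M {\<omega> \<in> space M. t \<le> N \<omega>} \<le> d * exp (- (\<theta> * t))"
      using eventually_gt_at_top[of 0] by eventually_elim (use chernoff that in \<open>simp add: algebra_simps\<close>)
    ultimately have "measure M {\<omega> \<in> space M. t \<le> N \<omega>} \<le> 0"
      using tendsto_lowerbound[where F = "at_top :: real filter"] by fastforce
    then show ?thesis
      using measure_nonneg[of M "{\<omega> \<in> space M. t \<le> N \<omega>}"] by linarith
  qed
qed

end

section \<open>The rectangular matrix series\<close>

context prob_space begin

text \<open>Independent, centred coefficients of unit variance are orthonormal, so only diagonal terms survive.\<close>

lemma second_moment_matrix_series:
  fixes P :: "'k \<Rightarrow> complex^'n^'m" and Q :: "'k \<Rightarrow> complex^'p^'n"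
  assumes K: "finite K" and indep: "indep_vars (\<lambda>_. borel) \<xi> K"
    and mom: "\<And>k n. k \<in> K \<Longrightarrow> integrable M (\<lambda>\<omega>. \<xi> k \<omega> ^ n)"
    and mean: "\<And>k. k \<in> K \<Longrightarrow> (\<integral>\<omega>. \<xi> k \<omega> \<partial>M) = 0"
    and var: "\<And>k. k \<in> K \<Longrightarrow> (\<integral>\<omega>. \<xi> k \<omega> ^ 2 \<partial>M) = 1"
  shows "(\<integral>\<omega>. (\<Sum>k\<in>K. \<xi> k \<omega> *\<^sub>R P k) ** (\<Sum>k\<in>K. \<xi> k \<omega> *\<^sub>R Q k) \<partial>M) = (\<Sum>k\<in>K. P k ** Q k)"
proof -
  have cov: "integrable M (\<lambda>\<omega>. \<xi> j \<omega> * \<xi> k \<omega>) \<and> (\<integral>\<omega>. \<xi> j \<omega> * \<xi> k \<omega> \<partial>M) = (if j = k then 1 else 0)"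
    if jk: "j \<in> K" "k \<in> K" for j k
  proof (cases "j = k")
    case True
    then show ?thesis
      using mom[of k 2] var[of k] jk by (simp add: power2_eq_square)
  next
    case False
    have "indep_vars (\<lambda>_. borel) \<xi> {j, k}"
      using jk by (intro indep_vars_subset[OF indep]) auto
    moreover have "integrable M (\<xi> i)" if "i \<in> {j, k}" for i
      using mom[of i 1] jk that by auto
    ultimately show ?thesis
      using indep_vars_integrable[of "{j, k}" \<xi>] indep_vars_lebesgue_integral[of "{j, k}" \<xi>] False mean jk
      by simp
  qed
  have "(\<integral>\<omega>. (\<Sum>k\<in>K. \<xi> k \<omega> *\<^sub>R P k) ** (\<Sum>k\<in>K. \<xi> k \<omega> *\<^sub>R Q k) \<partial>M)
     = (\<integral>\<omega>. (\<Sum>k\<in>K. \<Sum>j\<in>K. (\<xi> j \<omega> * \<xi> k \<omega>) *\<^sub>R (P j ** Q k)) \<partial>M)"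
    by (simp add: matrix_mult_sum_left matrix_mult_sum_right matrix_mult_scaleR_left matrix_mult_scaleR_right
        scaleR_sum_right mult.commute)
  also have "\<dots> = (\<Sum>k\<in>K. \<Sum>j\<in>K. (\<integral>\<omega>. \<xi> j \<omega> * \<xi> k \<omega> \<partial>M) *\<^sub>R (P j ** Q k))"
    using cov by (simp add: Bochner_Integration.integral_sum)
  also have "\<dots> = (\<Sum>k\<in>K. \<Sum>j\<in>K. if j = k then P j ** Q k else 0)"
    using cov by (intro sum.cong refl) auto
  also have "\<dots> = (\<Sum>k\<in>K. P k ** Q k)"
    using K by simp
  finally show ?thesis .
qed

end

text \<open>Continuity is used for measurability of the norm of a random matrix.\<close>

lemma continuous_on_spectral_norm: "continuous_on UNIV (spectral_norm :: complex^'n^'m \<Rightarrow> real)"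
proof -
  have "bounded_bilinear (\<lambda>(A :: complex^'n^'m) x. A *v x)"
  proof -
    have "bilinear (\<lambda>(A :: complex^'n^'m) x. A *v x)"
      unfolding bilinear_def
      by (auto intro!: linearI simp: matrix_vector_mult_def vec_eq_iff sum.distrib
          distrib_left distrib_right scaleR_sum_right)
    then show ?thesis
      by (simp add: bilinear_conv_bounded_bilinear)
  qed
  from bounded_bilinear.pos_bounded[OF this] obtain c where c: "0 < c"
    "\<And>(A :: complex^'n^'m) x. norm (A *v x) \<le> norm A * norm x * c"
    by blast
  have le: "spectral_norm A \<le> c * norm A" for A :: "complex^'n^'m"
    unfolding spectral_norm_eq_onorm by (rule onorm_le) (use c in \<open>simp add: mult_ac\<close>)
  have tri: "spectral_norm A \<le> spectral_norm B + spectral_norm (A - B)" for A B :: "complex^'n^'m"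
  proof -
    have "(\<lambda>x. A *v x) = (\<lambda>x. B *v x + (A - B) *v x)"
      by (simp add: matrix_vector_mult_diff_rdistrib)
    then show ?thesis
      unfolding spectral_norm_eq_onorm
      using onorm_triangle[OF bounded_linear_complex_matrix[of B] bounded_linear_complex_matrix[of "A - B"]] by simp
  qed
  have "c-lipschitz_on UNIV (spectral_norm :: complex^'n^'m \<Rightarrow> real)"
  proof (rule lipschitz_onI)
    fix A B :: "complex^'n^'m"
    show "dist (spectral_norm A) (spectral_norm B) \<le> c * dist A B"
      using tri[of A B] tri[of B A] le[of "A - B"] le[of "B - A"]
      by (simp add: dist_norm norm_minus_commute abs_le_iff)
  qed (use c in simp)
  then show ?thesis
    by (rule lipschitz_on_continuous_on)
qed

theorem theorem4p1p1:
  fixes M :: "'a measure"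
    and K :: "'k set"
    and B :: "'k \<Rightarrow> complex ^ 'd2 ^ 'd1"
    and \<xi> :: "'k \<Rightarrow> 'a \<Rightarrow> real"
  assumes "prob_space M"
    and "finite K"
    and "prob_space.indep_vars M (\<lambda>_. borel) \<xi> K"
    and "(\<forall>k\<in>K. distributed M lborel (\<xi> k) std_normal_density) \<or> (\<forall>k\<in>K. rademacher M (\<xi> k))"
  shows "matrix_variance M (matrix_series K \<xi> B) =
           max (spectral_norm (\<Sum>k\<in>K. B k ** conj_transpose (B k)))
               (spectral_norm (\<Sum>k\<in>K. conj_transpose (B k) ** B k))
       \<and> integrable M (\<lambda>\<omega>. spectral_norm (matrix_series K \<xi> B \<omega>))
       \<and> (\<integral>\<omega>. spectral_norm (matrix_series K \<xi> B \<omega>) \<partial>M)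
           \<le> sqrt (2 * matrix_variance M (matrix_series K \<xi> B) * ln (real (CARD('d1) + CARD('d2))))
       \<and> (\<forall>t\<ge>0. measure M {\<omega> \<in> space M. t \<le> spectral_norm (matrix_series K \<xi> B \<omega>)}
           \<le> real (CARD('d1) + CARD('d2)) *
             exp (- t\<^sup>2 / (2 * matrix_variance M (matrix_series K \<xi> B))))
       \<and> (matrix_variance M (matrix_series K \<xi> B) = 0 \<longrightarrow>
           (\<forall>t>0. measure M {\<omega> \<in> space M. t \<le> spectral_norm (matrix_series K \<xi> B \<omega>)} = 0))"
proof -
  interpret prob_space M
    by fact
  note K = \<open>finite K\<close> and indep = \<open>prob_space.indep_vars M (\<lambda>_. borel) \<xi> K\<close>
  have mom: "integrable M (\<lambda>\<omega>. \<xi> k \<omega> ^ n)" and mean: "(\<integral>\<omega>. \<xi> k \<omega> \<partial>M) = 0"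
    and var: "(\<integral>\<omega>. \<xi> k \<omega> ^ 2 \<partial>M) = 1" if "k \<in> K" for k n
    using assms(4) that std_normal_rv(1-3) rademacher_rv(1-3) by blast+
  have stein: "0 \<le> (\<integral>\<omega>. stein_gap A Y p (\<xi> k \<omega>) \<partial>M)"
    if "k \<in> K" "hermitian A" "hermitian Y" for k p and A Y :: "complex^('d1 + 'd2)^('d1 + 'd2)"
    using assms(4) that std_normal_rv(4) rademacher_rv(4) by blast
  define Z where "Z = matrix_series K \<xi> B"
  define v where "v = max (spectral_norm (\<Sum>k\<in>K. B k ** conj_transpose (B k)))
               (spectral_norm (\<Sum>k\<in>K. conj_transpose (B k) ** B k))"
  define d where "d = real (CARD('d1) + CARD('d2))"
  have v0: "0 \<le> v"
    unfolding v_def by (simp add: le_max_iff_disj spectral_norm_nonneg)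
  have "1 \<le> real CARD('d1)" "1 \<le> real CARD('d2)"
    by (simp_all add: Suc_leI)
  then have d: "1 < d"
    unfolding d_def of_nat_add by linarith
  have variance: "matrix_variance M Z = v"
    using second_moment_matrix_series[OF K indep mom mean var, where P = B and Q = "\<lambda>k. conj_transpose (B k)"]
      second_moment_matrix_series[OF K indep mom mean var, where Q = B and P = "\<lambda>k. conj_transpose (B k)"]
    by (simp add: matrix_variance_def v_def Z_def matrix_series_def conj_transpose_sum conj_transpose_scaleR)
  have rv: "random_variable borel (\<xi> k)" if "k \<in> K" for k
    using indep that by (simp add: indep_vars_def)
  have Z: "random_variable borel Z"
    unfolding Z_def matrix_series_def[abs_def] by (intro borel_measurable_sum borel_measurable_scaleR rv) auto
  define N where "N \<omega> = spectral_norm (Z \<omega>)" for \<omega>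
  have N[measurable]: "random_variable borel N"
    unfolding N_def by (rule borel_measurable_continuous_on[OF continuous_on_spectral_norm Z])
  have N0: "0 \<le> N \<omega>" for \<omega>
    unfolding N_def by (rule spectral_norm_nonneg)
  have dil: "dilation (Z \<omega>) = (\<Sum>k\<in>K. \<xi> k \<omega> *\<^sub>R dilation (B k))" for \<omega>
    unfolding Z_def matrix_series_def by (simp add: linear_sum linear_cmul linear_dilation)
  have v_quad: "inner ((\<Sum>k\<in>K. dilation (B k) ** dilation (B k)) *v x) x \<le> v * (norm x)\<^sup>2" for x
    unfolding v_def by (rule inner_sum_dilation_sq_le)
  have N_le: "2 * N \<omega> ^ (2 * p) \<le> (norm (matrix_power (dilation (Z \<omega>)) p))\<^sup>2" for \<omega> p
    unfolding N_def by (rule spectral_norm_power_le_dilation)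
  have int_dil: "integrable M (\<lambda>\<omega>. (norm (matrix_power (dilation (Z \<omega>)) p))\<^sup>2)" for p
    unfolding dil by (rule hermitian_series_moment_step(1)[OF K indep mom hermitian_dilation stein v_quad])
      (auto intro: hermitian_dilation)
  have int_N: "integrable M (\<lambda>\<omega>. N \<omega> ^ (2 * p))" for p
  proof (rule Bochner_Integration.integrable_bound[OF int_dil])
    show "AE \<omega> in M. norm (N \<omega> ^ (2 * p)) \<le> norm ((norm (matrix_power (dilation (Z \<omega>)) p))\<^sup>2)"
    proof (rule AE_I2)
      fix \<omega>
      show "norm (N \<omega> ^ (2 * p)) \<le> norm ((norm (matrix_power (dilation (Z \<omega>)) p))\<^sup>2)"
        unfolding real_norm_def abs_of_nonneg[OF zero_le_power[OF N0]] abs_of_nonneg[OF zero_le_power2]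
        using N_le[of \<omega> p] zero_le_power[OF N0[of \<omega>], of "2 * p"] by linarith
    qed
  qed measurable
  have mom_N: "(\<integral>\<omega>. N \<omega> ^ (2 * p) \<partial>M) \<le> d / 2 * (fact (2 * p) / (2 ^ p * fact p) * v ^ p)" for p
  proof -
    define c where "c = fact (2 * p) / (2 ^ p * fact p) * v ^ p"
    have "2 * (\<integral>\<omega>. N \<omega> ^ (2 * p) \<partial>M) = (\<integral>\<omega>. 2 * N \<omega> ^ (2 * p) \<partial>M)"
      by simp
    also have "\<dots> \<le> (\<integral>\<omega>. (norm (matrix_power (dilation (Z \<omega>)) p))\<^sup>2 \<partial>M)"
      by (intro integral_mono integrable_mult_right int_N int_dil N_le)
    also have "\<dots> \<le> real CARD('d1 + 'd2) * c"
      unfolding dil c_def by (rule hermitian_series_moment_bound[OF K indep mom hermitian_dilation stein v_quad v0])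
        (auto intro: hermitian_dilation)
    also have "real CARD('d1 + 'd2) = d"
      by (simp add: d_def)
    finally show ?thesis
      unfolding c_def[symmetric] by simp
  qed
  have mgf: "integrable M (\<lambda>\<omega>. exp (\<theta> * N \<omega>))" "(\<integral>\<omega>. exp (\<theta> * N \<omega>) \<partial>M) \<le> d * exp (\<theta>\<^sup>2 * v / 2)" for \<theta>
    using exp_moment_from_even_moments[OF N int_N mom_N, of \<theta>] by simp_all
  note concl = subgaussian_expectation_and_tail[OF N N0 mgf d v0]
  show ?thesis
    unfolding Z_def[symmetric] variance N_def[symmetric] d_def[symmetric]
    by (intro conjI allI impI concl) (simp_all add: v_def)
qed

end
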